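(* Let $K$ be a field, $S=K[x_1,\ldots,x_n]$ with $n\geq 2$, and let $I\subset S$ be a nonzero monomial ideal such that the set $\mathrm{Ass}(S/I)$ of associated prime ideals of $S/I$ is totally ordered by inclusion. Then $\mathrm{reg}(I)\leq m(I)(\deg(I)-1)+1$.
   Context: For a monomial ideal $I$, $G(I)$ denotes its minimal set of monomial generators, and $\deg(I)$ is the highest degree of a monomial of $G(I)$. For a monomial $u$, $m(u)=\max\{i : x_i\mid u\}$ (with $m(1)=0$), and $m(I)=\max_{u\in G(I)} m(u)$. The (Castelnuovo-Mumford) regularity of $I$ is $\mathrm{reg}(I)=\max\{j-i : \beta_{ij}(I)\neq 0\}$, where $\beta_{ij}(I)=\dim_K \mathrm{Tor}_i^S(I,K)_j$ are the graded Betti numbers of $I$ (standard grading on $S$). *)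

theory Defs
  imports
    "HOL-Library.Poly_Mapping"
    "HOL-Library.Extended_Nat"
    "HOL-Algebra.Ideal"
begin

text \<open>
  A monomial is represented by its exponent vector, a finitely supported
  function on the variable indices.  Thus \<open>x\<^sub>i\<close> divides \<open>u\<close> iff \<open>i\<close> is a key of \<open>u\<close>, and the
  monomial \<open>1\<close> is the exponent vector \<open>0\<close>.
\<close>

type_synonym pp = "nat \<Rightarrow>\<^sub>0 nat"
type_synonym 'k mpoly = "pp \<Rightarrow>\<^sub>0 'k"

definition monomials :: "nat \<Rightarrow> pp set" where
  "monomials n = {u. Poly_Mapping.keys u \<subseteq> {1..n}}"

definition poly_ring :: "nat \<Rightarrow> ('k::field) mpoly ring" where
  "poly_ring n = \<lparr>carrier = {p. Poly_Mapping.keys p \<subseteq> monomials n},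
     monoid.mult = (*), one = 1, zero = 0, add = (+)\<rparr>"

abbreviation mon :: "pp \<Rightarrow> ('k::field) mpoly" where
  "mon u \<equiv> Poly_Mapping.single u 1"

definition pp_deg :: "pp \<Rightarrow> nat" where
  "pp_deg u = (\<Sum>i\<in>Poly_Mapping.keys u. Poly_Mapping.lookup u i)"

definition pp_max :: "pp \<Rightarrow> nat" where
  "pp_max u = (if u = 0 then 0 else Max (Poly_Mapping.keys u))"


section \<open>Monomial ideals and associated primes\<close>

definition monomial_ideal :: "nat \<Rightarrow> ('k::field) mpoly set \<Rightarrow> bool" where
  "monomial_ideal n I \<longleftrightarrow> (\<exists>U \<subseteq> monomials n. I = Idl\<^bsub>poly_ring n\<^esub> (mon ` U))"

definition min_gens :: "nat \<Rightarrow> ('k::field) mpoly set \<Rightarrow> pp set" where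
  "min_gens n I = (THE G. G \<subseteq> monomials n \<and> Idl\<^bsub>poly_ring n\<^esub> (mon ` G) = I \<and>
     (\<forall>H. H \<subset> G \<longrightarrow> Idl\<^bsub>poly_ring n\<^esub> (mon ` H) \<noteq> I))"

definition ideal_deg :: "nat \<Rightarrow> ('k::field) mpoly set \<Rightarrow> nat" where
  "ideal_deg n I = Max (pp_deg ` min_gens n I)"

definition ideal_max :: "nat \<Rightarrow> ('k::field) mpoly set \<Rightarrow> nat" where
  "ideal_max n I = Max (pp_max ` min_gens n I)"

text \<open>
  \<open>Ass(R/I)\<close>: the prime ideals of \<open>R\<close> which are the annihilator of some element \<open>f + I\<close> of
  the module \<open>R/I\<close>.
\<close>

definition Ass_quot :: "('a, 'm) ring_scheme \<Rightarrow> 'a set \<Rightarrow> 'a set set" where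
  "Ass_quot R I = {P. primeideal P R \<and>
     (\<exists>f \<in> carrier R. P = {s \<in> carrier R. s \<otimes>\<^bsub>R\<^esub> f \<in> I})}"


section \<open>Graded free resolutions\<close>

definition smult :: "'a \<Rightarrow> ('b \<Rightarrow>\<^sub>0 'a) \<Rightarrow> ('b \<Rightarrow>\<^sub>0 'a::semiring_0)" where
  "smult c v = Poly_Mapping.map (\<lambda>a. c * a) v"

text \<open>
  A graded complex \<open>\<dots> \<rightarrow> F\<^sub>2 \<rightarrow> F\<^sub>1 \<rightarrow> F\<^sub>0 \<rightarrow> S\<close> of free modules with homogeneous bases.
  \<open>F\<^sub>i\<close> has the basis \<open>basis F i\<close>, whose element \<open>b\<close> sits in degree \<open>bdeg F i b\<close>, so that
  \<open>F\<^sub>i\<close> is the direct sum of the modules \<open>S(- bdeg F i b)\<close>.  The maps are given by their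
  values on the bases: \<open>aug F\<close> describes \<open>F\<^sub>0 \<rightarrow> S\<close> and \<open>bdry F i\<close> describes
  \<open>F\<^sub>i\<^sub>+\<^sub>1 \<rightarrow> F\<^sub>i\<close>.  Natural numbers suffice as labels of the basis elements, since every
  finitely generated graded module over \<open>S\<close> has a graded free resolution with finite bases.
\<close>

record (overloaded) 'k free_complex =
  basis :: "nat \<Rightarrow> nat set"
  bdeg :: "nat \<Rightarrow> nat \<Rightarrow> int"
  aug :: "nat \<Rightarrow> 'k mpoly"
  bdry :: "nat \<Rightarrow> nat \<Rightarrow> (nat \<Rightarrow>\<^sub>0 'k mpoly)"

definition free_mod :: "nat \<Rightarrow> nat set \<Rightarrow> (nat \<Rightarrow>\<^sub>0 ('k::field) mpoly) set" where
  "free_mod n B = {v. Poly_Mapping.keys v \<subseteq> B \<and>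
     (\<forall>b. Poly_Mapping.lookup v b \<in> carrier (poly_ring n))}"

definition aug_map :: "('k::field) free_complex \<Rightarrow> (nat \<Rightarrow>\<^sub>0 'k mpoly) \<Rightarrow> 'k mpoly" where
  "aug_map F v = (\<Sum>b\<in>Poly_Mapping.keys v. Poly_Mapping.lookup v b * aug F b)"

definition bdry_map ::
    "('k::field) free_complex \<Rightarrow> nat \<Rightarrow> (nat \<Rightarrow>\<^sub>0 'k mpoly) \<Rightarrow> (nat \<Rightarrow>\<^sub>0 'k mpoly)" where
  "bdry_map F i v = (\<Sum>b\<in>Poly_Mapping.keys v. smult (Poly_Mapping.lookup v b) (bdry F i b))"

text \<open>
  The first two conjuncts say that the maps are well-defined and homogeneous of degree 0,
  the remaining ones that \<open>\<dots> \<rightarrow> F\<^sub>1 \<rightarrow> F\<^sub>0 \<rightarrow> I \<rightarrow> 0\<close> is exact.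
\<close>

definition graded_free_resolution ::
    "nat \<Rightarrow> ('k::field) mpoly set \<Rightarrow> 'k free_complex \<Rightarrow> bool" where
  "graded_free_resolution n I F \<longleftrightarrow>
     (\<forall>b \<in> basis F 0. aug F b \<in> carrier (poly_ring n) \<and>
        (\<forall>u \<in> Poly_Mapping.keys (aug F b). int (pp_deg u) = bdeg F 0 b)) \<and>
     (\<forall>i. \<forall>b \<in> basis F (Suc i). bdry F i b \<in> free_mod n (basis F i) \<and>
        (\<forall>c. \<forall>u \<in> Poly_Mapping.keys (Poly_Mapping.lookup (bdry F i b) c).
           int (pp_deg u) + bdeg F i c = bdeg F (Suc i) b)) \<and>
     aug_map F ` free_mod n (basis F 0) = I \<and>
     {v \<in> free_mod n (basis F 0). aug_map F v = 0} =
        bdry_map F 0 ` free_mod n (basis F 1) \<and>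
     (\<forall>i. {v \<in> free_mod n (basis F (Suc i)). bdry_map F i v = 0} =
        bdry_map F (Suc i) ` free_mod n (basis F (Suc (Suc i))))"


section \<open>Tor, graded Betti numbers and regularity\<close>

text \<open>
  \<open>K = S/(x\<^sub>1,\<dots>,x\<^sub>n)\<close>, so \<open>F\<^sub>i \<otimes>\<^sub>S K\<close> is the \<open>K\<close>-vector space with basis \<open>basis F i\<close>, and the
  matrix of the induced map \<open>F\<^sub>i\<^sub>+\<^sub>1 \<otimes>\<^sub>S K \<rightarrow> F\<^sub>i \<otimes>\<^sub>S K\<close> consists of the constant terms of the
  entries of the matrix of \<open>F\<^sub>i\<^sub>+\<^sub>1 \<rightarrow> F\<^sub>i\<close>.
\<close>

definition tensor_bdry ::
    "('k::field) free_complex \<Rightarrow> nat \<Rightarrow> (nat \<Rightarrow>\<^sub>0 'k) \<Rightarrow> (nat \<Rightarrow>\<^sub>0 'k)" where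
  "tensor_bdry F i v =
     (\<Sum>b\<in>Poly_Mapping.keys v.
        smult (Poly_Mapping.lookup v b) (Poly_Mapping.map (\<lambda>p. Poly_Mapping.lookup p 0) (bdry F i b)))"

definition tensor_chains :: "('k::field) free_complex \<Rightarrow> nat \<Rightarrow> int \<Rightarrow> (nat \<Rightarrow>\<^sub>0 'k) set" where
  "tensor_chains F i j = {v. Poly_Mapping.keys v \<subseteq> {b \<in> basis F i. bdeg F i b = j}}"

definition tensor_cycles :: "('k::field) free_complex \<Rightarrow> nat \<Rightarrow> int \<Rightarrow> (nat \<Rightarrow>\<^sub>0 'k) set" where
  "tensor_cycles F i j =
     {v \<in> tensor_chains F i j. \<forall>l. i = Suc l \<longrightarrow> tensor_bdry F l v = 0}"

definition tensor_boundaries :: "('k::field) free_complex \<Rightarrow> nat \<Rightarrow> int \<Rightarrow> (nat \<Rightarrow>\<^sub>0 'k) set" where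
  "tensor_boundaries F i j = tensor_bdry F i ` tensor_chains F (Suc i) j"

text \<open>
  The dimension (possibly infinite) of the quotient \<open>Z/B\<close> of two subspaces \<open>B \<subseteq> Z\<close>: the largest
  size of a subset of \<open>Z\<close> that is linearly independent modulo \<open>B\<close>.
\<close>

definition quot_dim :: "('b \<Rightarrow>\<^sub>0 'k::field) set \<Rightarrow> ('b \<Rightarrow>\<^sub>0 'k) set \<Rightarrow> enat" where
  "quot_dim Z B = (SUP X \<in> {X. finite X \<and> X \<subseteq> Z \<and>
     (\<forall>c. (\<Sum>x\<in>X. smult (c x) x) \<in> B \<longrightarrow> (\<forall>x\<in>X. c x = 0))}. enat (card X))"

text \<open>
  \<open>\<beta>\<^sub>i\<^sub>j(I) = dim\<^sub>K Tor\<^sub>i\<^sup>S(I, K)\<^sub>j\<close>, where \<open>Tor\<^sub>i\<^sup>S(I, K)\<close> is the \<open>i\<close>-th homology of \<open>F \<otimes>\<^sub>S K\<close> for a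
  graded free resolution \<open>F\<close> of \<open>I\<close>; as usual, it does not depend on the choice of \<open>F\<close>.
\<close>

definition betti :: "nat \<Rightarrow> ('k::field) mpoly set \<Rightarrow> nat \<Rightarrow> int \<Rightarrow> enat" where
  "betti n I i j = (let F = (SOME F. graded_free_resolution n I F) in
     quot_dim (tensor_cycles F i j) (tensor_boundaries F i j))"

definition reg :: "nat \<Rightarrow> ('k::field) mpoly set \<Rightarrow> int" where
  "reg n I = Max {j - int i | i j. betti n I i j \<noteq> 0}"

end

theory Submission
  imports Defs "HOL-Library.Nat_Bijection"
begin

text \<open>
  Koszul homology of \<open>I\<close> splits into multidegrees.  In multidegree \<open>a\<close> it is the homology of a simplicial
  complex, which is a cone with apex \<open>k\<close> as soon as \<open>u/x\<^sub>k \<in> I\<close> for all monomials \<open>u \<in> I\<close> that divide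
  \<open>x\<^sup>a\<close>, are divisible by \<open>x\<^sub>k\<close> and have degree at least \<open>m(I)(deg(I) - 1) + 2\<close>; the homology then
  vanishes in these degrees.  Since the associated primes form a chain, there is a variable \<open>x\<^sub>k\<close>
  dividing \<open>x\<^sup>a\<close> such that every associated prime containing \<open>x\<^sub>k\<close> contains all variables dividing
  \<open>x\<^sup>a\<close>.  If \<open>v = u/x\<^sub>k\<close> were not in \<open>I\<close>, then \<open>v x\<^sub>l\<^sup>N \<in> I\<close> for every \<open>x\<^sub>l\<close> dividing \<open>v\<close> and large \<open>N\<close>, so some
  generator has a larger exponent at \<open>x\<^sub>l\<close> than \<open>v\<close>, which forces \<open>deg(v) \<le> m(I)(deg(I) - 1)\<close>.

  Koszul homology bounds the Betti numbers computed from any graded free resolution by a zigzag in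
  a double complex, and a resolution exists by Taylor's construction.  The Koszul complex and
  Taylor's resolution are contracted by the same cone construction.
\<close>

text \<open>The Betti numbers are read off a resolution chosen by \<open>SOME\<close>, so the
  argument has to cover every graded free resolution, possibly a non-minimal one. Resolutions are
  not compared: only the implication from vanishing Koszul homology to vanishing Betti numbers is
  needed, and the zigzag gives it directly.

  A cone contracts a strand only if its apex is the same for all faces in one multidegree; hence x_k
  may depend on a but not on u. The chain condition makes the sets of associated primes containing a
  given variable nested, and x_k is a variable dividing x^a for which this set is smallest. If no
  power of x_l carried v into I, some associated prime would contain x_k, since v x_k lies in I, but
  not x_l, against this choice.

  As v has at most m(I) variables, each with exponent at most deg(I) - 1, and u has one degree more,
  the contradiction starts at degree m(I)(deg(I) - 1) + 2. Since \<open>reg\<close> is a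
  \<open>Max\<close>, its set of values must also be finite and nonempty; this takes vanishing in
  negative degrees and one nonzero Betti number.\<close>

abbreviation lookup :: "('a \<Rightarrow>\<^sub>0 'b::zero) \<Rightarrow> 'a \<Rightarrow> 'b" where "lookup \<equiv> Poly_Mapping.lookup"
abbreviation keys :: "('a \<Rightarrow>\<^sub>0 'b::zero) \<Rightarrow> 'a set" where "keys \<equiv> Poly_Mapping.keys"
abbreviation single :: "'a \<Rightarrow> 'b \<Rightarrow> ('a \<Rightarrow>\<^sub>0 'b::zero)" where "single \<equiv> Poly_Mapping.single"

section \<open>Simplicial chains\<close>

text \<open>Meant for t outside T: the sign with which T occurs in the oriented boundary of
  \<open>insert t T\<close>.\<close>

definition face_sign :: "nat \<Rightarrow> nat set \<Rightarrow> 'a::comm_ring_1" where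
  "face_sign t T = (-1) ^ card {s \<in> T. s < t}"

lemma face_sign_insert:
  assumes "finite T" "k \<notin> T"
  shows "face_sign j (insert k T) = (if k < j then - face_sign j T else (face_sign j T :: 'a::comm_ring_1))"
proof -
  have "{s \<in> insert k T. s < j} = (if k < j then insert k {s \<in> T. s < j} else {s \<in> T. s < j})"
    by auto
  then show ?thesis using assms by (simp add: face_sign_def)
qed

lemma face_sign_sq [simp]: "face_sign t T * face_sign t T = (1::'a::comm_ring_1)"
  by (simp add: face_sign_def flip: power_mult_distrib)

lemma face_sign_nonzero [simp]: "face_sign t T \<noteq> (0::'a::field)"
  using face_sign_sq[of t T, where ?'a = 'a] by fastforce

lemma face_sign_sq_assoc: "face_sign t T * (face_sign t T * x) = (x::'a::comm_ring_1)"
  by (simp flip: mult.assoc)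

text \<open>The boundary operator of the full simplex on \<open>R\<close>, written coefficientwise:
  the value at T collects the values at the faces with one vertex more. The empty face is included,
  so the complex is the augmented one.\<close>

definition simplicial_diff :: "nat set \<Rightarrow> (nat set \<Rightarrow> 'a::comm_ring_1) \<Rightarrow> nat set \<Rightarrow> 'a" where
  "simplicial_diff R f T = (\<Sum>t\<in>R - T. face_sign t T * f (insert t T))"

text \<open>A face with two more vertices s and t is reached in both orders; exchanging the order
  changes exactly one of the two signs, so the terms cancel in pairs.\<close>

lemma simplicial_diff_simplicial_diff:
  assumes "finite R" "T \<subseteq> R"
  shows "simplicial_diff R (simplicial_diff R f) T = (0::'a::comm_ring_1)"
proof -
  have fT: "finite T" using assms finite_subset by blast
  let ?h = "\<lambda>t s. face_sign t T * (face_sign s (insert t T) * f (insert s (insert t T)))"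
  let ?P = "{(t, s). t \<in> R - T \<and> s \<in> R - T \<and> s < t}"
  let ?Q = "{(t, s). t \<in> R - T \<and> s \<in> R - T \<and> t < s}"
  have fin: "finite ?P" "finite ?Q"
    by (rule finite_subset[OF _ finite_cartesian_product[OF assms(1) assms(1)]]; auto)+
  have "simplicial_diff R (simplicial_diff R f) T = (\<Sum>t\<in>R - T. \<Sum>s\<in>R - insert t T. ?h t s)"
    by (simp add: simplicial_diff_def sum_distrib_left)
  also have "\<dots> = (\<Sum>(t, s)\<in>Sigma (R - T) (\<lambda>t. R - insert t T). ?h t s)"
    using assms by (intro sum.Sigma) auto
  also have "Sigma (R - T) (\<lambda>t. R - insert t T) = ?P \<union> ?Q"
    by auto
  also have "(\<Sum>(t, s)\<in>?P \<union> ?Q. ?h t s) = (\<Sum>(t, s)\<in>?P. ?h t s) + (\<Sum>(t, s)\<in>?Q. ?h t s)"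
    using fin by (intro sum.union_disjoint) auto
  also have "(\<Sum>(t, s)\<in>?Q. ?h t s) = (\<Sum>(t, s)\<in>?P. ?h s t)"
    by (rule sum.reindex_bij_witness[of _ "\<lambda>(t,s). (s,t)" "\<lambda>(t,s). (s,t)"]) auto
  also have "\<dots> = (\<Sum>(t, s)\<in>?P. - ?h t s)"
    using fT by (intro sum.cong) (auto simp: face_sign_insert insert_commute algebra_simps)
  also have "\<dots> = - (\<Sum>(t, s)\<in>?P. ?h t s)"
    by (simp add: sum_negf case_prod_unfold)
  finally show ?thesis by simp
qed

definition cone :: "nat \<Rightarrow> (nat set \<Rightarrow> 'a::comm_ring_1) \<Rightarrow> nat set \<Rightarrow> 'a" where
  "cone k f T = (if k \<in> T then face_sign k (T - {k}) * f (T - {k}) else 0)"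

text \<open>Joining with \<open>k\<close> is a homotopy between the identity and zero. If k is not
  in T, only the summand t = k survives. If k is in T, everything cancels except the summand that
  removes \<open>k\<close> and inserts it again.\<close>

lemma simplicial_diff_cone:
  assumes "finite R" "T \<subseteq> R" "k \<in> R"
  shows "simplicial_diff R (cone k f) T + cone k (simplicial_diff R f) T = (f T :: 'a::comm_ring_1)"
proof (cases "k \<in> T")
  case False
  have "simplicial_diff R (cone k f) T = (\<Sum>t\<in>R - T. if t = k then f T else 0)"
    using False unfolding simplicial_diff_def by (intro sum.cong) (auto simp: cone_def face_sign_sq_assoc)
  then show ?thesis using False assms by (simp add: cone_def)
next
  case True
  define U where "U = T - {k}"
  have U: "T = insert k U" "k \<notin> U" "finite U" "U \<subseteq> R"
    using True assms finite_subset[of T R] by (auto simp: U_def)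
  have [simp]: "insert t (insert k U) - {k} = insert t U" if "t \<notin> U" "t \<noteq> k" for t
    using that U(2) by auto
  have [simp]: "insert k U - {k} = U" using U by auto
  have "simplicial_diff R (cone k f) T = (\<Sum>t\<in>R - T. face_sign t (insert k U) * (face_sign k (insert t U) * f (insert t U)))"
    unfolding simplicial_diff_def U(1) by (intro sum.cong refl) (simp add: cone_def)
  also have "\<dots> = (\<Sum>t\<in>R - T. - (face_sign k U * (face_sign t U * f (insert t U))))"
    using U(2,3) unfolding U(1) by (intro sum.cong refl) (simp add: face_sign_insert)
  finally have 1: "simplicial_diff R (cone k f) T = - (\<Sum>t\<in>R - T. face_sign k U * (face_sign t U * f (insert t U)))"
    by (simp add: sum_negf)
  have W: "R - U = insert k (R - T)" "k \<notin> R - T" "finite (R - T)" using U assms by auto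
  have "cone k (simplicial_diff R f) T = face_sign k U * (\<Sum>t\<in>insert k (R - T). face_sign t U * f (insert t U))"
    using True unfolding cone_def simplicial_diff_def U_def[symmetric] W(1) by simp
  also have "\<dots> = f T + (\<Sum>t\<in>R - T. face_sign k U * (face_sign t U * f (insert t U)))"
    unfolding sum.insert[OF W(3,2)] by (simp only: distrib_left sum_distrib_left face_sign_sq_assoc U(1)[symmetric])
  finally have "cone k (simplicial_diff R f) T = f T + (\<Sum>t\<in>R - T. face_sign k U * (face_sign t U * f (insert t U)))" .
  then show ?thesis using 1 by simp
qed

section \<open>Monomials\<close>

definition adds_pp :: "pp \<Rightarrow> pp \<Rightarrow> bool" (infix \<open>adds\<close> 50) where
  "u adds v \<longleftrightarrow> (\<forall>i. lookup u i \<le> lookup v i)"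

lemma adds_refl [simp]: "u adds u" by (simp add: adds_pp_def)
lemma adds_trans [trans]: "u adds v \<Longrightarrow> v adds w \<Longrightarrow> u adds w"
  unfolding adds_pp_def using le_trans by blast
lemma adds_add [simp]: "u adds u + w" "u adds w + u"
  by (simp_all add: adds_pp_def lookup_add)
lemma adds_addI: "u adds v \<Longrightarrow> u adds v + w"
  using adds_add(1) adds_trans by blast
lemma adds_diff_add: "u adds v \<Longrightarrow> (v - u) + u = v"
  by (auto simp: adds_pp_def lookup_add lookup_minus intro!: poly_mapping_eqI)
lemma adds_add_diff: "u adds v \<Longrightarrow> u + (v - u) = v"
  using adds_diff_add by (simp add: add.commute)
lemma adds_iff_ex: "u adds v \<longleftrightarrow> (\<exists>w. v = u + w)"
  by (metis adds_add(1) adds_diff_add add.commute)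
lemma adds_cancel [simp]: "u + w adds v + w \<longleftrightarrow> u adds v" "w + u adds w + v \<longleftrightarrow> u adds v"
  by (simp_all add: adds_pp_def lookup_add)

lemma pp_deg_superset: "finite A \<Longrightarrow> keys u \<subseteq> A \<Longrightarrow> pp_deg u = (\<Sum>i\<in>A. lookup u i)"
  unfolding pp_deg_def by (intro sum.mono_neutral_left) (auto simp: in_keys_iff)

lemma pp_deg_add [simp]: "pp_deg (u + v) = pp_deg u + pp_deg v"
proof -
  have "keys (u + v) \<subseteq> keys u \<union> keys v" by (rule keys_add)
  then show ?thesis
    using pp_deg_superset[of "keys u \<union> keys v"] by (simp add: lookup_add sum.distrib)
qed
lemma pp_deg_zero [simp]: "pp_deg 0 = 0" by (simp add: pp_deg_def)
lemma pp_deg_single [simp]: "pp_deg (single k a) = a"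
  by (simp add: pp_deg_def)
lemma pp_deg_0_iff [simp]: "pp_deg u = 0 \<longleftrightarrow> u = 0"
  by (auto simp: pp_deg_def in_keys_iff intro!: poly_mapping_eqI)
lemma lookup_le_pp_deg: "lookup u i \<le> pp_deg u"
proof (cases "i \<in> keys u")
  case True
  then show ?thesis unfolding pp_deg_def by (intro member_le_sum) auto
qed (simp add: in_keys_iff)
lemma adds_pp_deg: "u adds v \<Longrightarrow> pp_deg u \<le> pp_deg v"
  by (auto simp: adds_iff_ex)
lemma adds_pp_deg_eq: "u adds v \<Longrightarrow> pp_deg v \<le> pp_deg u \<Longrightarrow> u = v"
  by (auto simp: adds_iff_ex)

lemma keys_add_pp [simp]: "keys (u + v :: pp) = keys u \<union> keys v"
  by (auto simp: in_keys_iff lookup_add)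
lemma monomials_zero [simp]: "0 \<in> monomials n" by (simp add: monomials_def)
lemma monomials_add [simp]: "u + v \<in> monomials n \<longleftrightarrow> u \<in> monomials n \<and> v \<in> monomials n"
  by (auto simp: monomials_def)
lemma monomials_adds: "u adds v \<Longrightarrow> v \<in> monomials n \<Longrightarrow> u \<in> monomials n"
  by (auto simp: adds_iff_ex)
lemma monomials_single [simp]: "single k a \<in> monomials n \<longleftrightarrow> a = 0 \<or> k \<in> {1..n}"
  by (auto simp: monomials_def)
lemma single_adds_iff [simp]: "single k (Suc 0) adds u \<longleftrightarrow> k \<in> keys u"
  by (auto simp: adds_pp_def lookup_single in_keys_iff when_def Suc_le_eq)

section \<open>Polynomials\<close>

lemma sum_single_keys:
  fixes p :: "'k::comm_ring_1 mpoly"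
  shows "p = (\<Sum>u\<in>keys p. single u (lookup p u))"
  by (rule poly_mapping_eqI)
     (auto simp: lookup_sum lookup_single when_def in_keys_iff)

lemma lookup_single_mult:
  fixes p :: "'k::comm_ring_1 mpoly"
  shows "lookup (single m c * p) u = (if m adds u then c * lookup p (u - m) else 0)"
proof -
  have "lookup (single m c * p) u = (\<Sum>v\<in>keys p. if m + v = u then c * lookup p v else 0)"
    by (subst sum_single_keys[of p])
       (simp add: sum_distrib_left mult_single lookup_sum lookup_single when_def)
  also have "\<dots> = (\<Sum>v\<in>keys p. if m adds u \<and> v = u - m then c * lookup p v else 0)"
    by (intro sum.cong refl if_cong) (auto simp: adds_add_diff)
  also have "\<dots> = (if m adds u then c * lookup p (u - m) else 0)"
    by (auto simp: in_keys_iff)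
  finally show ?thesis .
qed

lemma keys_mult_ex:
  assumes "u \<in> keys (p * q :: 'k::comm_ring_1 mpoly)"
  obtains v w where "v \<in> keys p" "w \<in> keys q" "u = v + w"
  using keys_mult[of p q] assms by blast

lemma keys_sum_ex:
  assumes "u \<in> keys (\<Sum>i\<in>A. f i :: 'k::comm_ring_1 mpoly)"
  obtains i where "i \<in> A" "u \<in> keys (f i)"
  using that assms sum.not_neutral_contains_not_neutral[of "\<lambda>i. lookup (f i) u" A]
  by (auto simp: in_keys_iff lookup_sum)

section \<open>Taylor complexes\<close>

text \<open>One differential for two complexes: labels by least common multiples give Taylor's
  resolution, labels by products of variables the Koszul complex.\<close>

definition taylor_diff :: "(nat set \<Rightarrow> pp) \<Rightarrow> nat set \<Rightarrow> (nat set \<Rightarrow> 'k::field mpoly) \<Rightarrow> nat set \<Rightarrow> 'k mpoly" where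
  "taylor_diff L R f T = (\<Sum>t\<in>R - T. single (L (insert t T) - L T) (face_sign t T) * f (insert t T))"

definition mono_label :: "(nat set \<Rightarrow> pp) \<Rightarrow> nat set \<Rightarrow> bool" where
  "mono_label L R \<longleftrightarrow> (\<forall>T t. T \<subseteq> R \<longrightarrow> t \<in> R \<longrightarrow> L T adds L (insert t T))"

text \<open>A monomial u at the face T has multidegree \<open>L T + u\<close>, and the strand keeps
  the scalars of multidegree \<open>a\<close>. The guard is there because subtraction of exponents
  is truncated.\<close>

definition strand :: "(nat set \<Rightarrow> pp) \<Rightarrow> (nat set \<Rightarrow> 'k::field mpoly) \<Rightarrow> pp \<Rightarrow> nat set \<Rightarrow> 'k" where
  "strand L f a T = (if L T adds a then lookup (f T) (a - L T) else 0)"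

lemma strand_eqI:
  assumes "\<And>a. strand L f a T = strand L g a T"
  shows "f T = g T"
proof (rule poly_mapping_eqI)
  fix u show "lookup (f T) u = lookup (g T) u"
    using assms[of "L T + u"] by (simp add: strand_def)
qed

text \<open>The monomial factors are the ones that preserve multidegrees. In a fixed multidegree
  just the signs remain, which turns statements on Taylor complexes into statements on simplicial
  chains.\<close>

lemma strand_taylor_diff:
  assumes L: "mono_label L R" and T: "T \<subseteq> R"
  shows "strand L (taylor_diff L R f) a T = simplicial_diff R (strand L f a) T"
proof -
  have summand: "(if L T adds a then lookup (single (L (insert t T) - L T) (face_sign t T) * f (insert t T)) (a - L T) else 0)
     = face_sign t T * strand L f a (insert t T)" if "t \<in> R - T" for t
  proof -
    have le: "L T adds L (insert t T)" using L T that by (auto simp: mono_label_def)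
    then obtain m where m: "L (insert t T) = L T + m" by (auto simp: adds_iff_ex)
    show ?thesis
    proof (cases "L T adds a")
      case True
      then obtain c where c: "a = L T + c" by (auto simp: adds_iff_ex)
      show ?thesis by (simp add: m c strand_def lookup_single_mult flip: diff_diff_eq)
    next
      case False
      then have "\<not> L (insert t T) adds a" using le adds_trans by blast
      with False show ?thesis by (simp add: strand_def)
    qed
  qed
  have "strand L (taylor_diff L R f) a T =
    (\<Sum>t\<in>R - T. if L T adds a then lookup (single (L (insert t T) - L T) (face_sign t T) * f (insert t T)) (a - L T) else 0)"
    by (auto simp: strand_def taylor_diff_def lookup_sum)
  then show ?thesis using summand by (simp add: simplicial_diff_def)
qed

lemma simplicial_diff_cong: "T \<subseteq> R \<Longrightarrow> (\<And>U. U \<subseteq> R \<Longrightarrow> f U = g U) \<Longrightarrow> simplicial_diff R f T = simplicial_diff R g T"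
  unfolding simplicial_diff_def by (intro sum.cong) auto

lemma taylor_diff_taylor_diff:
  assumes L: "mono_label L R" "finite R" "T \<subseteq> R"
  shows "taylor_diff L R (taylor_diff L R f) T = 0"
proof -
  have "taylor_diff L R (taylor_diff L R f) T = (\<lambda>_. 0) T"
  proof (rule strand_eqI[of L])
    fix a
    have "strand L (taylor_diff L R (taylor_diff L R f)) a T = simplicial_diff R (strand L (taylor_diff L R f) a) T"
      using L by (simp add: strand_taylor_diff)
    also have "\<dots> = simplicial_diff R (simplicial_diff R (strand L f a)) T"
      using L by (intro simplicial_diff_cong) (auto simp: strand_taylor_diff)
    also have "\<dots> = 0" using L by (simp add: simplicial_diff_simplicial_diff)
    finally show "strand L (taylor_diff L R (taylor_diff L R f)) a T = strand L (\<lambda>_. 0) a T"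
      by (simp add: strand_def)
  qed
  then show ?thesis by simp
qed

text \<open>The multigraded strand of a Taylor complex in degree \<open>a\<close> is contracted by the cone
  with apex \<open>\<kappa> a\<close>.\<close>

lemma taylor_exact:
  fixes f :: "nat set \<Rightarrow> 'k::field mpoly"
  assumes L: "mono_label L R" and R: "finite R"
    and supp: "\<And>T. f T \<noteq> 0 \<Longrightarrow> T \<subseteq> R"
    and cyc: "\<And>T. T \<subseteq> R \<Longrightarrow> taylor_diff L R f T = 0"
    and apex: "\<And>T u. T \<subseteq> R \<Longrightarrow> u \<in> keys (f T) \<Longrightarrow>
       \<kappa> (L T + u) \<in> R \<and> L (insert (\<kappa> (L T + u)) T) adds L T + u"
  obtains g where "\<And>T. g T \<noteq> 0 \<Longrightarrow> T \<subseteq> R"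
    and "\<And>T. T \<subseteq> R \<Longrightarrow> taylor_diff L R g T = f T"
    and "\<And>T u. u \<in> keys (g T) \<Longrightarrow> \<exists>k w. k = \<kappa> (L T + u) \<and> k \<in> T \<and> w \<in> keys (f (T - {k})) \<and>
       L (T - {k}) + w = L T + u"
proof -
  define s where "s = strand L f"
  \<comment> \<open>\<open>g\<close> is prescribed coefficient by coefficient: its strand of
    multidegree \<open>a\<close> is to be the cone with apex \<open>\<kappa> a\<close> over the
    strand of \<open>f\<close>.\<close>
  define c where "c T u = (if T \<subseteq> R then cone (\<kappa> (L T + u)) (s (L T + u)) T else 0)" for T u
  have c_nz: "\<exists>k w. k = \<kappa> (L T + u) \<and> k \<in> T \<and> w \<in> keys (f (T - {k})) \<and> L (T - {k}) + w = L T + u"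
    if "c T u \<noteq> 0" for T u
  proof -
    define k where "k = \<kappa> (L T + u)"
    have "k \<in> T" "s (L T + u) (T - {k}) \<noteq> 0" using that by (auto simp: c_def cone_def k_def split: if_splits)
    then have "L (T - {k}) adds L T + u" "L T + u - L (T - {k}) \<in> keys (f (T - {k}))"
      by (auto simp: s_def strand_def in_keys_iff split: if_splits)
    then show ?thesis using \<open>k \<in> T\<close> k_def adds_add_diff by blast
  qed
  \<comment> \<open>Only finitely supported coefficients define a polynomial: each comes from a
    monomial of \<open>f\<close> at one of the finitely many facets of T.\<close>
  have fin: "finite {u. c T u \<noteq> 0}" for T
  proof (cases "T \<subseteq> R")
    case True
    then have "finite T" using R finite_subset by blast
    have "{u. c T u \<noteq> 0} \<subseteq> (\<Union>k\<in>T. (\<lambda>w. L (T - {k}) + w - L T) ` keys (f (T - {k})))"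
    proof
      fix u assume "u \<in> {u. c T u \<noteq> 0}"
      then obtain k w where "k \<in> T" "w \<in> keys (f (T - {k}))" "L (T - {k}) + w = L T + u"
        using c_nz by blast
      then show "u \<in> (\<Union>k\<in>T. (\<lambda>w. L (T - {k}) + w - L T) ` keys (f (T - {k})))"
        by (intro UN_I[of k] image_eqI[of _ _ w]) auto
    qed
    then show ?thesis by (rule finite_subset) (use \<open>finite T\<close> in auto)
  qed (simp add: c_def)
  define g where "g T = Abs_poly_mapping (c T)" for T
  have lg: "lookup (g T) u = c T u" for T u
    unfolding g_def using fin by simp
  have strand_g: "strand L g a T = cone (\<kappa> a) (s a) T" if "T \<subseteq> R" for a T
  proof (cases "L T adds a")
    case True
    then show ?thesis using that by (simp add: strand_def lg c_def adds_add_diff)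
  next
    case False
    \<comment> \<open>The cone might be nonzero at a face whose label does not divide
      \<open>a\<close>, where \<open>g\<close> has no coefficient to realise it; \<open>apex\<close>
      excludes this.\<close>
    have "\<not> (\<kappa> a \<in> T \<and> s a (T - {\<kappa> a}) \<noteq> 0)"
    proof
      assume *: "\<kappa> a \<in> T \<and> s a (T - {\<kappa> a}) \<noteq> 0"
      then have "L (T - {\<kappa> a}) adds a" "a - L (T - {\<kappa> a}) \<in> keys (f (T - {\<kappa> a}))"
        by (auto simp: s_def strand_def in_keys_iff split: if_splits)
      then have "L (insert (\<kappa> a) (T - {\<kappa> a})) adds a"
        using apex[of "T - {\<kappa> a}" "a - L (T - {\<kappa> a})"] that by (auto simp: adds_add_diff)
      then show False using False * by (simp add: insert_absorb)
    qed
    then show ?thesis using False by (auto simp: strand_def cone_def)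
  qed
  have gf: "taylor_diff L R g T = f T" if T: "T \<subseteq> R" for T
  proof (rule strand_eqI[of L])
    fix a
    \<comment> \<open>Without an apex in \<open>R\<close> the strand vanishes and both sides are
      zero.\<close>
    have "s a U = 0" if "\<kappa> a \<notin> R" "U \<subseteq> R" for U
      using that apex[of U "a - L U"]
      by (cases "L U adds a") (auto simp: s_def strand_def in_keys_iff adds_add_diff)
    then have z: "s a T = simplicial_diff R (cone (\<kappa> a) (s a)) T" if "\<kappa> a \<notin> R"
      using that T by (auto simp: simplicial_diff_def cone_def intro!: sum.neutral)
    have z': "simplicial_diff R (s a) U = 0" if "U \<subseteq> R" for U
      unfolding s_def strand_taylor_diff[OF L that, symmetric] by (simp add: strand_def cyc[OF that])
    then have "cone k (simplicial_diff R (s a)) T = 0" for k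
      using z'[OF subset_trans[OF Diff_subset T]] by (auto simp: cone_def)
    then have "simplicial_diff R (cone (\<kappa> a) (s a)) T = s a T"
      using z simplicial_diff_cone[OF R T, of "\<kappa> a" "s a"] by (cases "\<kappa> a \<in> R") simp_all
    moreover have "strand L (taylor_diff L R g) a T = simplicial_diff R (cone (\<kappa> a) (s a)) T"
      unfolding strand_taylor_diff[OF L T] using T strand_g by (intro simplicial_diff_cong) auto
    ultimately show "strand L (taylor_diff L R g) a T = strand L f a T" by (simp add: s_def)
  qed
  have gR: "T \<subseteq> R" if "g T \<noteq> 0" for T
  proof (rule ccontr)
    assume "\<not> T \<subseteq> R"
    then have "g T = 0" by (intro poly_mapping_eqI) (simp add: lg c_def)
    with that show False by simp
  qed
  have gk: "\<exists>k w. k = \<kappa> (L T + u) \<and> k \<in> T \<and> w \<in> keys (f (T - {k})) \<and> L (T - {k}) + w = L T + u"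
    if "u \<in> keys (g T)" for T u
    using that by (intro c_nz) (simp add: in_keys_iff lg)
  show ?thesis by (rule that[OF gR gf gk])
qed

section \<open>Graded free modules\<close>

lemma carrier_poly_ring [simp]: "carrier (poly_ring n) = {p. keys p \<subseteq> monomials n}"
  by (simp add: poly_ring_def)

lemma lookup_smult [simp]: "lookup (smult c v) b = c * lookup v b"
  by (simp add: smult_def Poly_Mapping.map.rep_eq when_def)

lemma smult_zero [simp]: "smult c 0 = 0" by (rule poly_mapping_eqI) simp
lemma keys_add_sub: "keys p \<subseteq> A \<Longrightarrow> keys q \<subseteq> A \<Longrightarrow> keys (p + q) \<subseteq> A"
  using keys_add[of p q] by blast
lemma keys_mult_monomials:
  "keys p \<subseteq> monomials n \<Longrightarrow> keys q \<subseteq> monomials n \<Longrightarrow> keys (p * q :: 'k::field mpoly) \<subseteq> monomials n"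
  by (rule subsetI, erule keys_mult_ex) auto

text \<open>The common form of the augmentation and the boundary maps, so that both can be treated
  as maps between free modules.\<close>

definition lin_map :: "(nat \<Rightarrow> nat \<Rightarrow>\<^sub>0 'k::field mpoly) \<Rightarrow> (nat \<Rightarrow>\<^sub>0 'k mpoly) \<Rightarrow> (nat \<Rightarrow>\<^sub>0 'k mpoly)" where
  "lin_map D v = (\<Sum>b\<in>keys v. smult (lookup v b) (D b))"

lemma bdry_map_lin_map: "bdry_map F i = lin_map (bdry F i)"
  by (simp add: fun_eq_iff bdry_map_def lin_map_def)

lemma lookup_lin_map:
  assumes "finite B" "keys v \<subseteq> B"
  shows "lookup (lin_map D v) c = (\<Sum>b\<in>B. lookup v b * lookup (D b) c)"
  unfolding lin_map_def lookup_sum lookup_smult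
  using assms by (intro sum.mono_neutral_left) (auto simp: in_keys_iff)

lemma lin_map_zero [simp]: "lin_map D 0 = 0" by (simp add: lin_map_def)
lemma lin_map_add: "lin_map D (v + w) = lin_map D v + lin_map D w"
proof (rule poly_mapping_eqI)
  have k: "keys (v + w) \<subseteq> keys v \<union> keys w" by (rule keys_add)
  show "lookup (lin_map D (v + w)) c = lookup (lin_map D v + lin_map D w) c" for c
    using k by (simp add: lookup_add lookup_lin_map[of "keys v \<union> keys w"] distrib_right sum.distrib)
qed
lemma lin_map_smult: "lin_map D (smult p v) = smult p (lin_map D v)"
proof (rule poly_mapping_eqI)
  have k: "keys (smult p v) \<subseteq> keys v" by (auto simp: in_keys_iff)
  show "lookup (lin_map D (smult p v)) c = lookup (smult p (lin_map D v)) c" for c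
    using k by (simp add: lookup_lin_map[of "keys v"] sum_distrib_left mult.assoc)
qed
lemma lin_map_diff: "lin_map D (v - w) = lin_map D v - lin_map D w"
  using lin_map_add[of D "v - w" w] by simp
lemma lin_map_sum: "lin_map D (\<Sum>i\<in>A. f i) = (\<Sum>i\<in>A. lin_map D (f i))"
  by (induction A rule: infinite_finite_induct) (simp_all add: lin_map_add)

definition hom_mod :: "nat \<Rightarrow> nat set \<Rightarrow> (nat \<Rightarrow> int) \<Rightarrow> int \<Rightarrow> (nat \<Rightarrow>\<^sub>0 'k::field mpoly) set" where
  "hom_mod n B dg j = {v \<in> free_mod n B. \<forall>b. \<forall>u\<in>keys (lookup v b). int (pp_deg u) + dg b = j}"

lemma free_mod_iff:
  "v \<in> free_mod n B \<longleftrightarrow> (\<forall>b u. u \<in> keys (lookup v b) \<longrightarrow> b \<in> B \<and> u \<in> monomials n)"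
proof
  assume *: "\<forall>b u. u \<in> keys (lookup v b) \<longrightarrow> b \<in> B \<and> u \<in> monomials n"
  have "keys v \<subseteq> B"
  proof
    fix b assume "b \<in> keys v"
    then have "keys (lookup v b) \<noteq> {}" by (auto simp: in_keys_iff)
    then show "b \<in> B" using * by blast
  qed
  then show "v \<in> free_mod n B" using * by (auto simp: free_mod_def)
next
  assume v: "v \<in> free_mod n B"
  have "b \<in> keys v" if "u \<in> keys (lookup v b)" for b u
    using that by (auto simp: in_keys_iff)
  then show "\<forall>b u. u \<in> keys (lookup v b) \<longrightarrow> b \<in> B \<and> u \<in> monomials n"
    using v by (auto simp: free_mod_def)
qed

lemma hom_mod_iff:
  "v \<in> hom_mod n B dg j \<longleftrightarrow>
    (\<forall>b u. u \<in> keys (lookup v b) \<longrightarrow> b \<in> B \<and> u \<in> monomials n \<and> int (pp_deg u) + dg b = j)"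
  unfolding hom_mod_def using free_mod_iff[of v n B] by blast

lemma hom_mod_deg: "v \<in> hom_mod n B dg j \<Longrightarrow> u \<in> keys (lookup v b) \<Longrightarrow> int (pp_deg u) = j - dg b"
  by (force simp: hom_mod_iff)
lemma hom_mod_monomials: "v \<in> hom_mod n B dg j \<Longrightarrow> u \<in> keys (lookup v b) \<Longrightarrow> u \<in> monomials n"
  by (simp add: hom_mod_iff)
lemma hom_mod_free: "v \<in> hom_mod n B dg j \<Longrightarrow> v \<in> free_mod n B"
  by (simp add: hom_mod_def)
lemma hom_mod_0 [simp]: "0 \<in> hom_mod n B dg j" by (simp add: hom_mod_iff)
lemma hom_mod_diff:
  assumes "v \<in> hom_mod n B dg j" "w \<in> hom_mod n B dg j"
  shows "v - w \<in> hom_mod n B dg j"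
  unfolding hom_mod_iff
proof (intro allI impI)
  fix b u assume "u \<in> keys (lookup (v - w) b)"
  then have "u \<in> keys (lookup v b) \<or> u \<in> keys (lookup w b)"
    by (auto simp: in_keys_iff lookup_minus)
  then show "b \<in> B \<and> u \<in> monomials n \<and> int (pp_deg u) + dg b = j"
    using assms by (auto simp: hom_mod_iff)
qed
lemma hom_mod_add:
  assumes "v \<in> hom_mod n B dg j" "w \<in> hom_mod n B dg j"
  shows "v + w \<in> hom_mod n B dg j"
  unfolding hom_mod_iff
proof (intro allI impI)
  fix b u assume "u \<in> keys (lookup (v + w) b)"
  then have "u \<in> keys (lookup v b) \<or> u \<in> keys (lookup w b)"
    by (auto simp: in_keys_iff lookup_add)
  then show "b \<in> B \<and> u \<in> monomials n \<and> int (pp_deg u) + dg b = j"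
    using assms by (auto simp: hom_mod_iff)
qed
lemma hom_mod_sum: "(\<And>i. i \<in> A \<Longrightarrow> f i \<in> hom_mod n B dg j) \<Longrightarrow> (\<Sum>i\<in>A. f i) \<in> hom_mod n B dg j"
  by (induction A rule: infinite_finite_induct) (simp_all add: hom_mod_add)

lemma hom_mod_smult:
  assumes "v \<in> hom_mod n B dg j" "\<And>u. u \<in> keys p \<Longrightarrow> u \<in> monomials n \<and> int (pp_deg u) = e"
  shows "smult p v \<in> hom_mod n B dg (e + j)"
  unfolding hom_mod_iff
proof (intro allI impI)
  fix b u assume "u \<in> keys (lookup (smult p v) b)"
  then have "u \<in> keys (p * lookup v b)" by simp
  then obtain x y where "x \<in> keys p" "y \<in> keys (lookup v b)" "u = x + y" by (rule keys_mult_ex)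
  then show "b \<in> B \<and> u \<in> monomials n \<and> int (pp_deg u) + dg b = e + j"
    using assms by (auto simp: hom_mod_iff)
qed

lemma lin_map_hom_mod:
  assumes D: "\<And>b. b \<in> B' \<Longrightarrow> D b \<in> hom_mod n B dg (dg' b)" and v: "v \<in> hom_mod n B' dg' j"
  shows "lin_map D v \<in> hom_mod n B dg j"
  unfolding lin_map_def
proof (rule hom_mod_sum)
  fix b assume "b \<in> keys v"
  then have "b \<in> B'" using hom_mod_free[OF v] by (auto simp: free_mod_def)
  then have "smult (lookup v b) (D b) \<in> hom_mod n B dg ((j - dg' b) + dg' b)"
    using v by (intro hom_mod_smult D) (auto dest: hom_mod_deg hom_mod_monomials)
  then show "smult (lookup v b) (D b) \<in> hom_mod n B dg j" by simp
qed

section \<open>Homogeneous components of polynomials and of module elements\<close>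

definition hom_part :: "int \<Rightarrow> 'k::field mpoly \<Rightarrow> 'k mpoly" where
  "hom_part d = Poly_Mapping.mapp (\<lambda>u c. if int (pp_deg u) = d then c else 0)"

lemma lookup_hom_part: "lookup (hom_part d p) u = (if int (pp_deg u) = d then lookup p u else 0)"
  by (simp add: hom_part_def lookup_mapp when_def in_keys_iff)
lemma hom_part_0 [simp]: "hom_part d 0 = 0" by (simp add: hom_part_def lookup_mapp poly_mapping_eqI)
lemma hom_part_add: "hom_part d (p + q) = hom_part d p + hom_part d q"
  by (rule poly_mapping_eqI) (simp add: lookup_hom_part lookup_add)
lemma hom_part_sum: "hom_part d (\<Sum>i\<in>A. f i) = (\<Sum>i\<in>A. hom_part d (f i))"
  by (induction A rule: infinite_finite_induct) (simp_all add: hom_part_add)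
lemma hom_part_id: "(\<And>u. u \<in> keys p \<Longrightarrow> int (pp_deg u) = d) \<Longrightarrow> hom_part d p = p"
  by (rule poly_mapping_eqI) (auto simp: lookup_hom_part in_keys_iff)
lemma keys_hom_part: "u \<in> keys (hom_part d p) \<longleftrightarrow> u \<in> keys p \<and> int (pp_deg u) = d"
  by (auto simp: in_keys_iff lookup_hom_part)

text \<open>The components of \<open>p\<close> in degrees other than d contribute no monomial of
  degree d + e to the product.\<close>

lemma hom_part_mult:
  assumes "\<And>u. u \<in> keys q \<Longrightarrow> int (pp_deg u) = e"
  shows "hom_part (d + e) (p * q) = hom_part d p * q"
proof -
  define r where "r = p - hom_part d p"
  have "hom_part (d + e) (hom_part d p * q) = hom_part d p * q"
    by (rule hom_part_id) (auto elim!: keys_mult_ex simp: keys_hom_part assms)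
  moreover have "u \<notin> keys (hom_part (d + e) (r * q))" for u
    by (auto elim!: keys_mult_ex simp: keys_hom_part assms)
       (auto simp: r_def in_keys_iff lookup_minus lookup_hom_part)
  then have "hom_part (d + e) (r * q) = 0" by (simp add: in_keys_iff poly_mapping_eqI)
  moreover have "p * q = hom_part d p * q + r * q" by (simp add: r_def algebra_simps)
  ultimately show ?thesis by (simp add: hom_part_add)
qed

definition proj :: "(nat \<Rightarrow> int) \<Rightarrow> int \<Rightarrow> (nat \<Rightarrow>\<^sub>0 'k::field mpoly) \<Rightarrow> (nat \<Rightarrow>\<^sub>0 'k mpoly)" where
  "proj dg j = Poly_Mapping.mapp (\<lambda>b. hom_part (j - dg b))"

lemma lookup_proj: "lookup (proj dg j v) b = hom_part (j - dg b) (lookup v b)"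
  by (simp add: proj_def lookup_mapp when_def in_keys_iff)
lemma proj_id: "v \<in> hom_mod n B dg j \<Longrightarrow> proj dg j v = v"
  by (rule poly_mapping_eqI) (auto simp: lookup_proj dest: hom_mod_deg intro!: hom_part_id)
lemma proj_hom_mod: "v \<in> free_mod n B \<Longrightarrow> proj dg j v \<in> hom_mod n B dg j"
  by (auto simp: hom_mod_iff free_mod_iff lookup_proj keys_hom_part)

text \<open>The matrix entries of \<open>D\<close> are homogeneous of the degrees prescribed by
  \<open>dg'\<close> and \<open>dg\<close>. Exactness is given for the whole modules; passing to a
  component of a preimage makes it usable degree by degree.\<close>

lemma lin_map_proj:
  assumes D: "\<And>b. b \<in> B' \<Longrightarrow> D b \<in> hom_mod n B dg (dg' b)" and v: "v \<in> free_mod n B'"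
  shows "lin_map D (proj dg' j v) = proj dg j (lin_map D v)"
proof (rule poly_mapping_eqI)
  fix c
  have k: "keys (proj dg' j v) \<subseteq> keys v" unfolding proj_def by (rule keys_mapp_subset)
  have *: "hom_part (j - dg' b) (lookup v b) * lookup (D b) c = hom_part (j - dg c) (lookup v b * lookup (D b) c)"
    if "b \<in> keys v" for b
  proof -
    have "b \<in> B'" using that v by (auto simp: free_mod_def)
    then have "int (pp_deg u) = dg' b - dg c" if "u \<in> keys (lookup (D b) c)" for u
      using hom_mod_deg[OF D that] by simp
    from hom_part_mult[of "lookup (D b) c", OF this, of "j - dg' b"] show ?thesis by simp
  qed
  have "lookup (lin_map D (proj dg' j v)) c = (\<Sum>b\<in>keys v. hom_part (j - dg' b) (lookup v b) * lookup (D b) c)"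
    using k by (simp add: lookup_lin_map[of "keys v"] lookup_proj)
  also have "\<dots> = (\<Sum>b\<in>keys v. hom_part (j - dg c) (lookup v b * lookup (D b) c))"
    using * by (intro sum.cong) auto
  also have "\<dots> = lookup (proj dg j (lin_map D v)) c"
    by (simp add: lookup_lin_map[of "keys v"] lookup_proj hom_part_sum)
  finally show "lookup (lin_map D (proj dg' j v)) c = lookup (proj dg j (lin_map D v)) c" .
qed

section \<open>Koszul complexes\<close>

definition var_label :: "nat set \<Rightarrow> pp" where
  "var_label T = (\<Sum>t\<in>T. single t 1)"

lemma lookup_var_label: "finite T \<Longrightarrow> lookup (var_label T) i = (if i \<in> T then 1 else 0)"
  by (simp add: var_label_def lookup_sum lookup_single when_def)
lemma var_label_insert: "finite T \<Longrightarrow> t \<notin> T \<Longrightarrow> var_label (insert t T) = single t 1 + var_label T"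
  by (simp add: var_label_def)
lemma var_label_empty [simp]: "var_label {} = 0" by (simp add: var_label_def)
lemma var_label_monomials: "T \<subseteq> {1..n} \<Longrightarrow> var_label T \<in> monomials n"
  by (auto simp: monomials_def in_keys_iff lookup_var_label finite_subset[of T "{1..n}"] subset_iff split: if_splits)

lemma mono_label_var_label: "finite R \<Longrightarrow> mono_label var_label R"
  by (auto simp: mono_label_def adds_pp_def lookup_var_label finite_subset)

text \<open>The Koszul complex with coefficients in a free module: the value of \<open>f\<close> at
  T is the coefficient of the exterior product of the e_t with t in T.\<close>

definition koszul_diff :: "nat \<Rightarrow> (nat set \<Rightarrow> (nat \<Rightarrow>\<^sub>0 'k::field mpoly)) \<Rightarrow> nat set \<Rightarrow> (nat \<Rightarrow>\<^sub>0 'k mpoly)" where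
  "koszul_diff n f T = (\<Sum>t\<in>{1..n} - T. smult (single (single t 1) (face_sign t T)) (f (insert t T)))"

lemma lookup_koszul_diff:
  assumes "T \<subseteq> {1..n}"
  shows "lookup (koszul_diff n f T) b = taylor_diff var_label {1..n} (\<lambda>S. lookup (f S) b) T"
proof -
  have "finite T" using assms finite_subset by blast
  then show ?thesis by (simp add: koszul_diff_def taylor_diff_def lookup_sum var_label_insert)
qed

lemma koszul_diff_minus: "koszul_diff n (\<lambda>T. f T - g T) T = koszul_diff n f T - koszul_diff n g T"
  by (rule poly_mapping_eqI) (simp add: koszul_diff_def lookup_sum lookup_minus sum_subtractf algebra_simps)

lemma koszul_diff_lin_map: "koszul_diff n (\<lambda>T. lin_map D (f T)) T = lin_map D (koszul_diff n f T)"
  by (simp add: koszul_diff_def lin_map_sum lin_map_smult)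

text \<open>Homological degree \<open>q\<close> and internal degree \<open>j\<close>: the exterior
  basis element of T has degree \<open>card T\<close>, so its coefficient has degree j - q.\<close>

definition koszul_chain :: "nat \<Rightarrow> nat set \<Rightarrow> (nat \<Rightarrow> int) \<Rightarrow> nat \<Rightarrow> int \<Rightarrow> (nat set \<Rightarrow> (nat \<Rightarrow>\<^sub>0 'k::field mpoly)) set" where
  "koszul_chain n B dg q j = {f. \<forall>T. (f T \<noteq> 0 \<longrightarrow> T \<subseteq> {1..n} \<and> card T = q) \<and> f T \<in> hom_mod n B dg (j - int q)}"

lemma koszul_chain_supp: "f \<in> koszul_chain n B dg q j \<Longrightarrow> f T \<noteq> 0 \<Longrightarrow> T \<subseteq> {1..n} \<and> card T = q"
  by (simp add: koszul_chain_def)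
lemma koszul_chain_hom: "f \<in> koszul_chain n B dg q j \<Longrightarrow> f T \<in> hom_mod n B dg (j - int q)"
  by (simp add: koszul_chain_def)

lemma koszul_chain_koszul_diff:
  assumes f: "f \<in> koszul_chain n B dg (Suc q) j"
  shows "koszul_diff n f \<in> koszul_chain n B dg q j"
  unfolding koszul_chain_def mem_Collect_eq
proof (intro allI conjI impI)
  fix T
  show "koszul_diff n f T \<in> hom_mod n B dg (j - int q)"
    unfolding koszul_diff_def
  proof (rule hom_mod_sum)
    fix t assume "t \<in> {1..n} - T"
    then have "smult (single (single t 1) (face_sign t T)) (f (insert t T)) \<in> hom_mod n B dg (1 + (j - int (Suc q)))"
      by (intro hom_mod_smult koszul_chain_hom[OF f]) auto
    then show "smult (single (single t 1) (face_sign t T)) (f (insert t T)) \<in> hom_mod n B dg (j - int q)" by simp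
  qed
  assume "koszul_diff n f T \<noteq> 0"
  then obtain t where t: "t \<in> {1..n} - T" "smult (single (single t 1) (face_sign t T)) (f (insert t T)) \<noteq> 0"
    unfolding koszul_diff_def by (meson sum.not_neutral_contains_not_neutral)
  then have "f (insert t T) \<noteq> 0" by auto
  from koszul_chain_supp[OF f this] have "insert t T \<subseteq> {1..n}" "card (insert t T) = Suc q" by auto
  moreover from this have "finite T" using finite_subset[of T "{1..n}"] by auto
  ultimately show "T \<subseteq> {1..n}" "card T = q" using t by auto
qed

lemma koszul_diff_outside: "f \<in> koszul_chain n B dg q j \<Longrightarrow> \<not> T \<subseteq> {1..n} \<Longrightarrow> koszul_diff n f T = 0"
proof -
  assume f: "f \<in> koszul_chain n B dg q j" and T: "\<not> T \<subseteq> {1..n}"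
  have "f (insert t T) = 0" for t using koszul_chain_supp[OF f, of "insert t T"] T by auto
  then show "koszul_diff n f T = 0" by (simp add: koszul_diff_def)
qed

lemma koszul_diff_koszul_diff:
  assumes f: "f \<in> koszul_chain n B dg (Suc q) j"
  shows "koszul_diff n (koszul_diff n f) T = 0"
proof (cases "T \<subseteq> {1..n}")
  case True
  show ?thesis
  proof (rule poly_mapping_eqI)
    fix b
    have "lookup (koszul_diff n (koszul_diff n f) T) b = taylor_diff var_label {1..n} (\<lambda>S. lookup (koszul_diff n f S) b) T"
      using True by (rule lookup_koszul_diff)
    also have "\<dots> = taylor_diff var_label {1..n} (taylor_diff var_label {1..n} (\<lambda>S. lookup (f S) b)) T"
      unfolding taylor_diff_def[of _ _ _ T] using True
      by (intro sum.cong refl) (simp add: lookup_koszul_diff)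
    finally show "lookup (koszul_diff n (koszul_diff n f) T) b = lookup 0 b"
      using True by (simp add: taylor_diff_taylor_diff mono_label_var_label)
  qed
qed (rule koszul_diff_outside[OF koszul_chain_koszul_diff[OF f]])

lemma koszul_chain_minus:
  assumes "f \<in> koszul_chain n B dg q j" "g \<in> koszul_chain n B dg q j"
  shows "(\<lambda>T. f T - g T) \<in> koszul_chain n B dg q j"
  unfolding koszul_chain_def mem_Collect_eq
proof (intro allI conjI impI)
  fix T
  show "f T - g T \<in> hom_mod n B dg (j - int q)"
    using assms by (intro hom_mod_diff koszul_chain_hom)
  assume "f T - g T \<noteq> 0"
  then have "f T \<noteq> 0 \<or> g T \<noteq> 0" by auto
  then show "T \<subseteq> {1..n}" "card T = q" using assms koszul_chain_supp by blast+
qed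

text \<open>In each coordinate \<open>b\<close> the cone construction applies: any variable dividing
  the multidegree may be the apex, since the label of the enlarged face still divides it. The last
  conclusion, that monomials of \<open>g\<close> arise from monomials of \<open>f\<close> by
  cancelling the apex variable, is what later keeps \<open>g\<close> inside the ideal.\<close>

lemma koszul_exact:
  fixes f :: "nat set \<Rightarrow> (nat \<Rightarrow>\<^sub>0 'k::field mpoly)"
  assumes f: "f \<in> koszul_chain n B dg q j" and cyc: "\<And>T. koszul_diff n f T = 0"
    and apex: "\<And>T b u. T \<subseteq> {1..n} \<Longrightarrow> u \<in> keys (lookup (f T) b) \<Longrightarrow> \<kappa> (var_label T + u) \<in> keys (var_label T + u)"
  obtains g where "g \<in> koszul_chain n B dg (Suc q) j" "koszul_diff n g = f"
    "\<And>T b u. u \<in> keys (lookup (g T) b) \<Longrightarrow> \<exists>k w. k = \<kappa> (var_label T + u) \<and> k \<in> T \<and> w \<in> keys (lookup (f (T - {k})) b) \<and>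
       single k 1 + u = w"
proof -
  let ?R = "{1..n}"
  define P where "P b g \<longleftrightarrow> (\<forall>T. g T \<noteq> 0 \<longrightarrow> T \<subseteq> ?R) \<and> (\<forall>T. T \<subseteq> ?R \<longrightarrow> taylor_diff var_label ?R g T = lookup (f T) b) \<and>
     (\<forall>T u. u \<in> keys (g T) \<longrightarrow> (\<exists>k w. k = \<kappa> (var_label T + u) \<and> k \<in> T \<and> w \<in> keys (lookup (f (T - {k})) b) \<and>
       var_label (T - {k}) + w = var_label T + u))" for b and g :: "nat set \<Rightarrow> 'k mpoly"
  have "\<exists>g. P b g" for b
  proof -
    let ?fb = "\<lambda>T. lookup (f T) b"
    have 1: "T \<subseteq> ?R" if "?fb T \<noteq> 0" for T
    proof -
      have "f T \<noteq> 0" using that by auto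
      then show ?thesis using koszul_chain_supp[OF f] by blast
    qed
    have 2: "taylor_diff var_label ?R ?fb T = 0" if "T \<subseteq> ?R" for T using cyc[of T] lookup_koszul_diff[OF that, of f b] by simp
    have 3: "\<kappa> (var_label T + u) \<in> ?R \<and> var_label (insert (\<kappa> (var_label T + u)) T) adds var_label T + u"
      if T: "T \<subseteq> ?R" and u: "u \<in> keys (?fb T)" for T u
    proof -
      have fT: "finite T" using T finite_subset by blast
      have k: "\<kappa> (var_label T + u) \<in> keys (var_label T + u)" using apex[OF T u] .
      have "var_label T + u \<in> monomials n"
        using var_label_monomials[OF T] hom_mod_monomials[OF koszul_chain_hom[OF f] u] by simp
      then have "\<kappa> (var_label T + u) \<in> ?R" using k unfolding monomials_def by blast
      moreover have "var_label (insert (\<kappa> (var_label T + u)) T) adds var_label T + u"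
        using k fT by (auto simp: adds_pp_def lookup_var_label lookup_add in_keys_iff)
      ultimately show ?thesis by blast
    qed
    show ?thesis
    proof (rule taylor_exact[OF mono_label_var_label[OF finite_atLeastAtMost] finite_atLeastAtMost 1 2 3], assumption+)
      fix g :: "nat set \<Rightarrow> 'k mpoly"
      assume "\<And>T. g T \<noteq> 0 \<Longrightarrow> T \<subseteq> ?R" "\<And>T. T \<subseteq> ?R \<Longrightarrow> taylor_diff var_label ?R g T = ?fb T"
        "\<And>T u. u \<in> keys (g T) \<Longrightarrow> \<exists>k w. k = \<kappa> (var_label T + u) \<and> k \<in> T \<and> w \<in> keys (?fb (T - {k})) \<and>
           var_label (T - {k}) + w = var_label T + u"
      then have "P b g" unfolding P_def by simp
      then show "\<exists>g. P b g" by (intro exI[of _ g])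
    qed
  qed
  then obtain G where G: "\<And>b. P b (G b)" by metis
  have Gsupp: "T \<subseteq> ?R" if "G b T \<noteq> 0" for b T using G[of b] that unfolding P_def by blast
  have Gtay: "taylor_diff var_label ?R (G b) T = lookup (f T) b" if "T \<subseteq> ?R" for b T
    using G[of b] that unfolding P_def by blast
  have Gkey: "\<exists>k w. k = \<kappa> (var_label T + u) \<and> k \<in> T \<and> w \<in> keys (lookup (f (T - {k})) b) \<and> single k 1 + u = w"
    if u: "u \<in> keys (G b T)" for b T u
  proof -
    obtain k w where kw: "k = \<kappa> (var_label T + u)" "k \<in> T" "w \<in> keys (lookup (f (T - {k})) b)"
       "var_label (T - {k}) + w = var_label T + u"
      using G[of b] u unfolding P_def by blast
    have "G b T \<noteq> 0" using u by auto
    then have "finite T" using Gsupp finite_subset by blast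
    then have "var_label T = single k 1 + var_label (T - {k})"
      using kw(2) var_label_insert[of "T - {k}" k] by (simp add: insert_absorb)
    then have "var_label (T - {k}) + (single k 1 + u) = var_label (T - {k}) + w" using kw(4) by (simp add: ac_simps)
    then show ?thesis using kw(1-3) by auto
  qed
  \<comment> \<open>The coordinates form an element of the free module: one of them can be nonzero
    at T only if \<open>f\<close> is nonzero in that coordinate at some face.\<close>
  have fin: "finite {b. G b T \<noteq> 0}" for T
  proof (rule finite_subset)
    show "{b. G b T \<noteq> 0} \<subseteq> (\<Union>U\<in>Pow ?R. keys (f U))"
    proof
      fix b assume "b \<in> {b. G b T \<noteq> 0}"
      then have "G b T \<noteq> 0" by simp
      then have "keys (G b T) \<noteq> {}" by simp
      then obtain u where "u \<in> keys (G b T)" by blast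
      from Gkey[OF this] obtain k w where "w \<in> keys (lookup (f (T - {k})) b)" by blast
      then have "b \<in> keys (f (T - {k}))" by (auto simp: in_keys_iff)
      moreover have "T - {k} \<subseteq> ?R" using Gsupp \<open>G b T \<noteq> 0\<close> by blast
      ultimately show "b \<in> (\<Union>U\<in>Pow ?R. keys (f U))" by blast
    qed
  qed simp
  define g where "g T = Abs_poly_mapping (\<lambda>b. G b T)" for T
  have lg: "lookup (g T) b = G b T" for T b
    unfolding g_def using fin by simp
  have key: "\<exists>k w. k = \<kappa> (var_label T + u) \<and> k \<in> T \<and> w \<in> keys (lookup (f (T - {k})) b) \<and> single k 1 + u = w"
    if "u \<in> keys (lookup (g T) b)" for T b u using Gkey that by (simp add: lg)
  have gC: "g \<in> koszul_chain n B dg (Suc q) j"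
    unfolding koszul_chain_def mem_Collect_eq
  proof (intro allI conjI impI)
    fix T
    show "g T \<in> hom_mod n B dg (j - int (Suc q))"
      unfolding hom_mod_iff
    proof (intro allI impI)
      fix b u assume "u \<in> keys (lookup (g T) b)"
      from key[OF this] obtain k w where "w \<in> keys (lookup (f (T - {k})) b)" "single k 1 + u = w" by blast
      then show "b \<in> B \<and> u \<in> monomials n \<and> int (pp_deg u) + dg b = j - int (Suc q)"
        using koszul_chain_hom[OF f, of "T - {k}"] by (force simp: hom_mod_iff)
    qed
    assume "g T \<noteq> 0"
    then obtain b where "lookup (g T) b \<noteq> 0" by (metis poly_mapping_eqI lookup_zero)
    then have T: "T \<subseteq> ?R" and "keys (lookup (g T) b) \<noteq> {}" using Gsupp by (auto simp: lg)
    then obtain u where "u \<in> keys (lookup (g T) b)" by blast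
    from key[OF this] obtain k where "k \<in> T" "f (T - {k}) \<noteq> 0" by fastforce
    then have "card (T - {k}) = q" "k \<in> T" using koszul_chain_supp[OF f] by auto
    moreover have "finite T" using T finite_subset by blast
    ultimately show "card T = Suc q" by (metis card.remove)
    show "T \<subseteq> ?R" by (rule T)
  qed
  have "koszul_diff n g T = f T" for T
  proof (cases "T \<subseteq> ?R")
    case True
    show ?thesis
      by (rule poly_mapping_eqI) (simp only: lookup_koszul_diff[OF True] lg Gtay[OF True])
  next
    case False
    then show ?thesis using koszul_diff_outside[OF gC] koszul_chain_supp[OF f, of T] by auto
  qed
  then show ?thesis by (intro that[OF gC _ key]) auto
qed

text \<open>The Koszul complex of a free module is acyclic except in multidegree zero, where no
  variable can be the apex. That strand consists of the constant terms at the empty face, which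
  \<open>const\<close> excludes.\<close>

lemma koszul_exact_free:
  assumes f: "f \<in> koszul_chain n B dg q j" and cyc: "\<And>T. koszul_diff n f T = 0"
    and const: "\<And>b. lookup (lookup (f {}) b) 0 = 0"
  obtains g where "g \<in> koszul_chain n B dg (Suc q) j" "koszul_diff n g = f"
proof -
  define \<kappa> :: "pp \<Rightarrow> nat" where "\<kappa> a = Min (keys a)" for a
  have apex: "\<kappa> (var_label T + u) \<in> keys (var_label T + u)" if "T \<subseteq> {1..n}" "u \<in> keys (lookup (f T) b)" for T b u
  proof -
    have fT: "finite T" using that finite_subset by blast
    have "keys (var_label T + u) \<noteq> {}"
    proof (cases "T = {}")
      case True
      then have "u \<noteq> 0" using that const[of b] by (auto simp: in_keys_iff)
      with True show ?thesis by (simp del: keys_add_pp)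
    next
      case False
      then obtain t where "t \<in> T" by blast
      then have "t \<in> keys (var_label T)" using fT by (simp add: in_keys_iff lookup_var_label)
      then show ?thesis by auto
    qed
    then show ?thesis unfolding \<kappa>_def by (intro Min_in) auto
  qed
  show ?thesis
    by (rule koszul_exact[of f n B dg q j \<kappa>, OF f cyc apex]) (assumption+, rule that)
qed

section \<open>Betti numbers from Koszul homology\<close>

text \<open>The complex is augmented and shifted: \<open>B 0\<close> is the basis \<open>{0}\<close> of \<open>S\<close>, in which \<open>I\<close> is embedded by
  \<open>single 0\<close>, and \<open>B (Suc p)\<close> is the basis of \<open>F\<^sub>p\<close>.\<close>

locale aug_res =
  fixes n :: nat and I :: "'k::field mpoly set" and B :: "nat \<Rightarrow> nat set"
    and dg :: "nat \<Rightarrow> nat \<Rightarrow> int" and D :: "nat \<Rightarrow> nat \<Rightarrow> (nat \<Rightarrow>\<^sub>0 'k mpoly)"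
  assumes D: "\<And>p b. b \<in> B (Suc p) \<Longrightarrow> D p b \<in> hom_mod n (B p) (dg p) (dg (Suc p) b)"
    and im0: "lin_map (D 0) ` free_mod n (B 1) = single 0 ` I"
    and exact: "\<And>p. {v \<in> free_mod n (B (Suc p)). lin_map (D p) v = 0} = lin_map (D (Suc p)) ` free_mod n (B (Suc (Suc p)))"
begin

lemma lin_map_D_hom: "v \<in> hom_mod n (B (Suc p)) (dg (Suc p)) j \<Longrightarrow> lin_map (D p) v \<in> hom_mod n (B p) (dg p) j"
  by (rule lin_map_hom_mod[OF D])

lemma lin_map_lin_map: "w \<in> hom_mod n (B (Suc (Suc p))) (dg (Suc (Suc p))) j \<Longrightarrow> lin_map (D p) (lin_map (D (Suc p)) w) = 0"
  using exact[of p] hom_mod_free by blast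

lemma hom_exact:
  assumes v: "v \<in> hom_mod n (B (Suc p)) (dg (Suc p)) j" and 0: "lin_map (D p) v = 0"
  shows "\<exists>w \<in> hom_mod n (B (Suc (Suc p))) (dg (Suc (Suc p))) j. lin_map (D (Suc p)) w = v"
proof -
  have "v \<in> lin_map (D (Suc p)) ` free_mod n (B (Suc (Suc p)))"
    unfolding exact[symmetric] using v 0 hom_mod_free by blast
  then obtain w where w: "w \<in> free_mod n (B (Suc (Suc p)))" "v = lin_map (D (Suc p)) w" by blast
  have "lin_map (D (Suc p)) (proj (dg (Suc (Suc p))) j w) = v"
    using lin_map_proj[OF D w(1)] proj_id[OF v] w(2) by simp
  then show ?thesis using proj_hom_mod[OF w(1)] by blast
qed

lemma hom_exact0:
  assumes v: "v \<in> hom_mod n (B 0) (dg 0) j" "v \<in> single 0 ` I"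
  shows "\<exists>w \<in> hom_mod n (B (Suc 0)) (dg (Suc 0)) j. lin_map (D 0) w = v"
proof -
  obtain w where w: "w \<in> free_mod n (B (Suc 0))" "v = lin_map (D 0) w" using v(2) im0 by auto
  have "lin_map (D 0) (proj (dg (Suc 0)) j w) = v"
    using lin_map_proj[OF D w(1)] proj_id[OF v(1)] w(2) by simp
  then show ?thesis using proj_hom_mod[OF w(1)] by blast
qed

lemma koszul_chain_lift:
  assumes f: "f \<in> koszul_chain n (B p) (dg p) q j"
    and ex: "\<And>T. \<exists>w \<in> hom_mod n (B p') (dg p') (j - int q). lin_map D' w = f T"
  obtains g where "g \<in> koszul_chain n (B p') (dg p') q j" "\<And>T. lin_map D' (g T) = f T"
proof -
  obtain h where h: "\<And>T. h T \<in> hom_mod n (B p') (dg p') (j - int q)" "\<And>T. lin_map D' (h T) = f T"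
    using ex by metis
  \<comment> \<open>Taking 0 wherever \<open>f\<close> is 0 keeps the support on faces of size
    \<open>q\<close>.\<close>
  define g where "g T = (if f T = 0 then 0 else h T)" for T
  have "g \<in> koszul_chain n (B p') (dg p') q j"
    using h(1) koszul_chain_supp[OF f] by (auto simp: koszul_chain_def g_def split: if_splits)
  moreover have "lin_map D' (g T) = f T" for T using h(2) by (simp add: g_def)
  ultimately show ?thesis by (rule that)
qed

lemma koszul_chain_lin_map:
  assumes f: "f \<in> koszul_chain n (B (Suc p)) (dg (Suc p)) q j"
  shows "(\<lambda>T. lin_map (D p) (f T)) \<in> koszul_chain n (B p) (dg p) q j"
  unfolding koszul_chain_def mem_Collect_eq
proof (intro allI conjI impI)
  fix T
  show "lin_map (D p) (f T) \<in> hom_mod n (B p) (dg p) (j - int q)"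
    by (rule lin_map_D_hom[OF koszul_chain_hom[OF f]])
  assume "lin_map (D p) (f T) \<noteq> 0"
  then have "f T \<noteq> 0" by auto
  then show "T \<subseteq> {1..n}" "card T = q" using koszul_chain_supp[OF f] by blast+
qed

text \<open>Vanishing in degree \<open>j\<close> of the Koszul homology of \<open>I\<close>, that
  is, of Tor of \<open>I\<close> and K computed from a resolution of K instead of one of
  \<open>I\<close>.\<close>

definition koszul_vanish :: "nat \<Rightarrow> int \<Rightarrow> bool" where
  "koszul_vanish i j \<longleftrightarrow> (\<forall>f \<in> koszul_chain n (B 0) (dg 0) i j. range f \<subseteq> single 0 ` I \<longrightarrow> (\<forall>T. koszul_diff n f T = 0) \<longrightarrow>
     (\<exists>g \<in> koszul_chain n (B 0) (dg 0) (Suc i) j. range g \<subseteq> single 0 ` I \<and> koszul_diff n g = f))"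

text \<open>The zigzag in the double complex of free modules and Koszul complexes: a chain whose image is a
  Koszul cycle is pushed along the Koszul differential until it reaches the augmentation.\<close>

lemma zigzag:
  assumes van: "koszul_vanish i j"
  shows "f \<in> koszul_chain n (B (Suc p)) (dg (Suc p)) q j \<Longrightarrow> p + q = i \<Longrightarrow>
    (\<And>T. koszul_diff n (\<lambda>T. lin_map (D p) (f T)) T = 0) \<Longrightarrow>
    (\<And>b. p \<noteq> 0 \<Longrightarrow> lookup (lookup (lin_map (D p) (f {})) b) 0 = 0) \<Longrightarrow>
    \<exists>y \<in> koszul_chain n (B (Suc p)) (dg (Suc p)) (Suc q) j.
    \<exists>w \<in> koszul_chain n (B (Suc (Suc p))) (dg (Suc (Suc p))) q j.
      \<forall>T. f T = koszul_diff n y T + lin_map (D (Suc p)) (w T)"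
proof (induction p arbitrary: f q)
  case 0
  let ?f = "\<lambda>T. lin_map (D 0) (f T)"
  have *: "?f \<in> koszul_chain n (B 0) (dg 0) i j" using koszul_chain_lin_map[OF "0.prems"(1)] "0.prems"(2) by simp
  have "range ?f \<subseteq> single 0 ` I"
    using im0 hom_mod_free[OF koszul_chain_hom[OF "0.prems"(1)]] by fastforce
  \<comment> \<open>The zigzag has reached the augmentation; here the vanishing of Koszul homology
    supplies a bounding chain inside \<open>I\<close>.\<close>
  then obtain y' where y': "y' \<in> koszul_chain n (B 0) (dg 0) (Suc i) j" "range y' \<subseteq> single 0 ` I" "koszul_diff n y' = ?f"
    using van * "0.prems"(3) unfolding koszul_vanish_def by blast
  have "\<exists>w \<in> hom_mod n (B (Suc 0)) (dg (Suc 0)) (j - int (Suc i)). lin_map (D 0) w = y' T" for T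
    using y'(2) by (intro hom_exact0 koszul_chain_hom[OF y'(1)]) auto
  from koszul_chain_lift[OF y'(1) this] obtain y
    where y: "y \<in> koszul_chain n (B (Suc 0)) (dg (Suc 0)) (Suc q) j" "\<And>T. lin_map (D 0) (y T) = y' T"
    using "0.prems"(2) by auto
  \<comment> \<open>Subtracting the Koszul boundary of the lift makes the augmentation vanish, so
    exactness of the resolution yields \<open>w\<close>.\<close>
  let ?g = "\<lambda>T. f T - koszul_diff n y T"
  have g: "?g \<in> koszul_chain n (B (Suc 0)) (dg (Suc 0)) q j"
    using "0.prems"(1) koszul_chain_koszul_diff[OF y(1)] by (rule koszul_chain_minus)
  have "lin_map (D 0) (?g T) = 0" for T
    using y(2) y'(3) by (simp add: lin_map_diff flip: koszul_diff_lin_map)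
  then have "\<exists>w \<in> hom_mod n (B (Suc (Suc 0))) (dg (Suc (Suc 0))) (j - int q). lin_map (D (Suc 0)) w = ?g T" for T
    by (intro hom_exact koszul_chain_hom[OF g])
  from koszul_chain_lift[OF g this] obtain w where w: "w \<in> koszul_chain n (B (Suc (Suc 0))) (dg (Suc (Suc 0))) q j"
    "\<And>T. lin_map (D (Suc 0)) (w T) = ?g T" by blast
  show ?case using w y(1) by (intro bexI[of _ y] bexI[of _ w]) auto
next
  case (Suc p)
  let ?f = "\<lambda>T. lin_map (D (Suc p)) (f T)"
  have Df: "?f \<in> koszul_chain n (B (Suc p)) (dg (Suc p)) q j" by (rule koszul_chain_lin_map[OF Suc.prems(1)])
  have "lookup (lookup (?f {}) b) 0 = 0" for b by (rule Suc.prems(4)) simp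
  from koszul_exact_free[OF Df Suc.prems(3) this] obtain f'
    where f': "f' \<in> koszul_chain n (B (Suc p)) (dg (Suc p)) (Suc q) j" "koszul_diff n f' = ?f" by blast
  \<comment> \<open>\<open>f'\<close> lives on nonempty faces, so the condition on constant terms
    has to be supplied only at the start of the zigzag and holds automatically from here on.\<close>
  have "f' {} = 0" using koszul_chain_supp[OF f'(1), of "{}"] by auto
  moreover have "koszul_diff n (\<lambda>T. lin_map (D p) (f' T)) T = 0" for T
    unfolding koszul_diff_lin_map f'(2) by (rule lin_map_lin_map[OF koszul_chain_hom[OF Suc.prems(1)]])
  ultimately obtain y w where y: "y \<in> koszul_chain n (B (Suc p)) (dg (Suc p)) (Suc (Suc q)) j"
    and w: "w \<in> koszul_chain n (B (Suc (Suc p))) (dg (Suc (Suc p))) (Suc q) j"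
    and f'_eq: "\<And>T. f' T = koszul_diff n y T + lin_map (D (Suc p)) (w T)"
    using Suc.IH[OF f'(1)] Suc.prems(2) by fastforce
  let ?g = "\<lambda>T. f T - koszul_diff n w T"
  have g: "?g \<in> koszul_chain n (B (Suc (Suc p))) (dg (Suc (Suc p))) q j"
    using Suc.prems(1) koszul_chain_koszul_diff[OF w] by (rule koszul_chain_minus)
  have "lin_map (D (Suc p)) (?g T) = 0" for T
  proof -
    \<comment> \<open>The two differentials commute, and the image of \<open>w\<close> differs from
      \<open>f'\<close> by a Koszul boundary, which the Koszul differential kills.\<close>
    have "lin_map (D (Suc p)) (koszul_diff n w T) = koszul_diff n (\<lambda>T. f' T - koszul_diff n y T) T"
      using f'_eq by (simp flip: koszul_diff_lin_map)
    also have "\<dots> = ?f T" using koszul_diff_koszul_diff[OF y] f'(2) by (simp add: koszul_diff_minus)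
    finally show ?thesis by (simp add: lin_map_diff)
  qed
  then have "\<exists>u \<in> hom_mod n (B (Suc (Suc (Suc p)))) (dg (Suc (Suc (Suc p)))) (j - int q).
      lin_map (D (Suc (Suc p))) u = ?g T" for T
    by (intro hom_exact koszul_chain_hom[OF g])
  from koszul_chain_lift[OF g this] obtain u
    where u: "u \<in> koszul_chain n (B (Suc (Suc (Suc p)))) (dg (Suc (Suc (Suc p)))) q j"
    "\<And>T. lin_map (D (Suc (Suc p))) (u T) = ?g T" by blast
  show ?case using u w by (intro bexI[of _ w] bexI[of _ u]) auto
qed

end

section \<open>Reduction of a resolution modulo the variables\<close>

abbreviation aug_basis :: "('k::field) free_complex \<Rightarrow> nat \<Rightarrow> nat set" where
  "aug_basis F \<equiv> case_nat {0} (basis F)"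
abbreviation aug_deg :: "('k::field) free_complex \<Rightarrow> nat \<Rightarrow> nat \<Rightarrow> int" where
  "aug_deg F \<equiv> case_nat (\<lambda>_. 0) (bdeg F)"
abbreviation aug_bdry :: "('k::field) free_complex \<Rightarrow> nat \<Rightarrow> nat \<Rightarrow> (nat \<Rightarrow>\<^sub>0 'k mpoly)" where
  "aug_bdry F \<equiv> case_nat (\<lambda>b. single 0 (aug F b)) (bdry F)"

lemma lin_map_aug: "lin_map (\<lambda>b. single 0 (aug F b)) v = single 0 (aug_map F v)"
proof (rule poly_mapping_eqI)
  show "lookup (lin_map (\<lambda>b. single 0 (aug F b)) v) c = lookup (single 0 (aug_map F v)) c" for c
    by (cases "c = 0") (simp_all add: lookup_lin_map[of "keys v"] aug_map_def lookup_single)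
qed

lemma single_inj: "single a x = single a y \<longleftrightarrow> x = y"
  by (metis lookup_single_eq)

lemma single_eq_0_iff [simp]: "single k x = 0 \<longleftrightarrow> x = 0"
  using single_inj[of k x 0] by simp

lemma pp_add_eq_0_iff [simp]: "(u :: pp) + v = 0 \<longleftrightarrow> u = 0 \<and> v = 0"
  by (metis pp_deg_add pp_deg_0_iff add_is_0)

lemma aug_res_of_resolution:
  assumes F: "graded_free_resolution n I F"
  shows "aug_res n I (aug_basis F) (aug_deg F) (aug_bdry F)"
proof
  fix p b assume b: "b \<in> aug_basis F (Suc p)"
  show "aug_bdry F p b \<in> hom_mod n (aug_basis F p) (aug_deg F p) (aug_deg F (Suc p) b)"
  proof (cases p)
    case 0
    then show ?thesis using F b
      by (auto simp: graded_free_resolution_def hom_mod_iff lookup_single when_def split: if_splits)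
  next
    case (Suc q)
    then have "bdry F q b \<in> free_mod n (basis F q)" "\<forall>c. \<forall>u\<in>keys (lookup (bdry F q b) c). int (pp_deg u) + bdeg F q c = bdeg F (Suc q) b"
      using F b unfolding graded_free_resolution_def by auto
    then show ?thesis using Suc by (simp add: hom_mod_def)
  qed
next
  have "aug_map F ` free_mod n (basis F 0) = I" using F by (simp add: graded_free_resolution_def)
  then show "lin_map (aug_bdry F 0) ` free_mod n (aug_basis F 1) = single 0 ` I"
    by (auto simp: lin_map_aug)
next
  fix p
  show "{v \<in> free_mod n (aug_basis F (Suc p)). lin_map (aug_bdry F p) v = 0} = lin_map (aug_bdry F (Suc p)) ` free_mod n (aug_basis F (Suc (Suc p)))"
  proof (cases p)
    case 0
    have "{v \<in> free_mod n (basis F 0). aug_map F v = 0} = bdry_map F 0 ` free_mod n (basis F 1)"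
      using F by (simp add: graded_free_resolution_def)
    then show ?thesis using 0 by (simp add: lin_map_aug bdry_map_lin_map)
  next
    case (Suc q)
    then show ?thesis using F by (simp add: graded_free_resolution_def bdry_map_lin_map)
  qed
qed

definition const_part :: "(nat \<Rightarrow>\<^sub>0 'k::field mpoly) \<Rightarrow> (nat \<Rightarrow>\<^sub>0 'k)" where
  "const_part v = Poly_Mapping.map (\<lambda>p. lookup p 0) v"
text \<open>A K-linear section of the reduction. It need not commute with the differentials: a
  lifted cycle is a cycle only modulo the variables.\<close>

definition const_lift :: "(nat \<Rightarrow>\<^sub>0 'k::field) \<Rightarrow> (nat \<Rightarrow>\<^sub>0 'k mpoly)" where
  "const_lift z = Poly_Mapping.map (single 0) z"

lemma lookup_const_part [simp]: "lookup (const_part v) b = lookup (lookup v b) 0"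
  by (simp add: const_part_def Poly_Mapping.map.rep_eq when_def)
lemma lookup_const_lift [simp]: "lookup (const_lift z) b = single 0 (lookup z b)"
  by (simp add: const_lift_def Poly_Mapping.map.rep_eq when_def)
lemma const_part_const_lift [simp]: "const_part (const_lift z) = z"
  by (rule poly_mapping_eqI) simp
lemma const_part_add: "const_part (v + w) = const_part v + const_part w"
  by (rule poly_mapping_eqI) (simp add: lookup_add)

lemma lookup_mult_0: "lookup (p * q :: 'k::field mpoly) 0 = lookup p 0 * lookup q 0"
proof -
  define r where "r = p - single 0 (lookup p 0)"
  have "0 \<notin> keys r" by (simp add: r_def in_keys_iff lookup_minus)
  then have "0 \<notin> keys (r * q)" by (metis keys_mult_ex pp_add_eq_0_iff)
  then have "lookup (r * q) 0 = 0" by (simp add: in_keys_iff)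
  moreover have "p * q = single 0 (lookup p 0) * q + r * q" by (simp add: r_def algebra_simps)
  ultimately show ?thesis by (simp add: lookup_add lookup_single_mult)
qed

lemma const_part_bdry_map: "const_part (bdry_map F i v) = tensor_bdry F i (const_part v)"
proof (rule poly_mapping_eqI)
  fix c
  have k: "keys (const_part v) \<subseteq> keys v" by (auto simp: in_keys_iff)
  have "lookup (tensor_bdry F i (const_part v)) c = (\<Sum>b\<in>keys (const_part v). lookup (const_part v) b * lookup (lookup (bdry F i b) c) 0)"
    unfolding tensor_bdry_def lookup_sum lookup_smult const_part_def[symmetric] by simp
  also have "\<dots> = (\<Sum>b\<in>keys v. lookup (const_part v) b * lookup (lookup (bdry F i b) c) 0)"
    using k by (intro sum.mono_neutral_left) (auto simp: in_keys_iff)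
  finally show "lookup (const_part (bdry_map F i v)) c = lookup (tensor_bdry F i (const_part v)) c"
    by (simp add: bdry_map_lin_map lookup_lin_map[of "keys v"] lookup_sum lookup_mult_0)
qed

lemma const_lift_hom_mod: "z \<in> tensor_chains F i j \<Longrightarrow> const_lift z \<in> hom_mod n (basis F i) (bdeg F i) j"
  by (auto simp: hom_mod_iff tensor_chains_def in_keys_iff lookup_single when_def subset_iff split: if_splits)

lemma const_part_hom_mod: "v \<in> hom_mod n (basis F i) (bdeg F i) j \<Longrightarrow> const_part v \<in> tensor_chains F i j"
  by (fastforce simp: hom_mod_iff tensor_chains_def in_keys_iff)

lemma const_part_koszul_diff: "lookup (const_part (koszul_diff n f T)) b = 0"
  by (simp add: koszul_diff_def lookup_sum lookup_mult_0 lookup_single when_def)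

text \<open>A cycle of the reduced complex is lifted to constants and placed at the empty face. The
  zigzag writes the lift as a combination with variables as coefficients plus a boundary of the
  resolution; modulo the variables only the boundary remains.\<close>

lemma tensor_cycles_boundaries:
  assumes F: "graded_free_resolution n I F"
    and van: "aug_res.koszul_vanish n I (aug_basis F) (aug_deg F) i j"
  shows "tensor_cycles F i j \<subseteq> tensor_boundaries F i j"
proof
  interpret aug_res n I "aug_basis F" "aug_deg F" "aug_bdry F" by (rule aug_res_of_resolution[OF F])
  fix z assume z: "z \<in> tensor_cycles F i j"
  then have zc: "z \<in> tensor_chains F i j" by (simp add: tensor_cycles_def)
  define f where "f T = (if T = {} then const_lift z else 0)" for T :: "nat set"
  have 1: "f \<in> koszul_chain n (aug_basis F (Suc i)) (aug_deg F (Suc i)) 0 j"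
    using const_lift_hom_mod[OF zc, of n] by (auto simp: koszul_chain_def f_def)
  have 2: "koszul_diff n (\<lambda>T. lin_map (aug_bdry F i) (f T)) T = 0" for T
    by (simp add: koszul_diff_def f_def)
  \<comment> \<open>For positive i the cycle condition says that the boundary of the lift has no
    constant terms.\<close>
  have 3: "lookup (lookup (lin_map (aug_bdry F i) (f {})) b) 0 = 0" if "i \<noteq> 0" for b
  proof -
    obtain l where l: "i = Suc l" using \<open>i \<noteq> 0\<close> not0_implies_Suc by blast
    then have "tensor_bdry F l z = 0" using z by (simp add: tensor_cycles_def)
    then show ?thesis
      using const_part_bdry_map[of F l "const_lift z"] lookup_const_part[of "bdry_map F l (const_lift z)" b]
      by (simp add: l f_def bdry_map_lin_map)
  qed
  from zigzag[OF van 1 _ 2 3] obtain y w where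
    w: "w \<in> koszul_chain n (aug_basis F (Suc (Suc i))) (aug_deg F (Suc (Suc i))) 0 j"
    and eq: "\<forall>T. f T = koszul_diff n y T + lin_map (aug_bdry F (Suc i)) (w T)" by auto
  have "const_lift z = koszul_diff n y {} + bdry_map F i (w {})"
    using eq[rule_format, of "{}"] by (simp add: f_def bdry_map_lin_map)
  then have "z = const_part (koszul_diff n y {}) + const_part (bdry_map F i (w {}))" by (metis const_part_const_lift const_part_add)
  moreover have "const_part (koszul_diff n y {}) = 0" by (rule poly_mapping_eqI) (use const_part_koszul_diff in simp)
  ultimately have "z = tensor_bdry F i (const_part (w {}))" by (simp add: const_part_bdry_map)
  moreover have "const_part (w {}) \<in> tensor_chains F (Suc i) j" using koszul_chain_hom[OF w, of "{}"] by (simp add: const_part_hom_mod)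
  ultimately show "z \<in> tensor_boundaries F i j" by (auto simp: tensor_boundaries_def)
qed

lemma smult_1 [simp]: "smult (1::'a::comm_semiring_1) v = v" by (rule poly_mapping_eqI) simp
lemma smult_0_left [simp]: "smult (0::'a::comm_semiring_1) v = 0" by (rule poly_mapping_eqI) simp

lemma quot_dim_eq_0:
  assumes "Z \<subseteq> B"
  shows "quot_dim Z B = 0"
proof -
  have "X = {}" if X: "finite X" "X \<subseteq> Z" "\<forall>c. (\<Sum>x\<in>X. smult (c x) x) \<in> B \<longrightarrow> (\<forall>x\<in>X. c x = 0)" for X
  proof (rule ccontr)
    assume "X \<noteq> {}"
    then obtain x where x: "x \<in> X" by blast
    have "(\<Sum>y\<in>X. smult (if y = x then 1 else 0) y) = (\<Sum>y\<in>X. if y = x then x else 0)"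
      by (intro sum.cong) auto
    also have "\<dots> = x" using X(1) x by simp
    finally have "(\<Sum>y\<in>X. smult (if y = x then 1 else 0) y) = x" .
    moreover have "x \<in> B" using x X(2) assms by blast
    ultimately have "(if x = x then 1 else 0) = (0::'b)"
      using X(3)[THEN spec, of "\<lambda>y. if y = x then 1 else 0"] x by (metis (no_types))
    then show False by simp
  qed
  then have "quot_dim Z B \<le> 0"
    unfolding quot_dim_def by (intro SUP_least) (auto simp: zero_enat_def)
  then show ?thesis by simp
qed

lemma quot_dim_neq_0:
  assumes "z \<in> Z" "\<And>c. smult c z \<in> B \<Longrightarrow> c = 0"
  shows "quot_dim Z B \<noteq> 0"
proof -
  have "enat (card {z}) \<le> quot_dim Z B"
    unfolding quot_dim_def by (rule SUP_upper) (use assms in auto)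
  then show ?thesis by (auto simp: zero_enat_def)
qed

text \<open>A monomial \<open>u0\<close> of least degree in \<open>I\<close> has a preimage under
  the augmentation. Its class survives because in this degree the augmentation depends on constant
  coefficients only, and it kills boundaries.\<close>

lemma betti_0_nonzero:
  assumes F: "graded_free_resolution n I F"
    and u0: "mon u0 \<in> I" "u0 \<in> monomials n"
    and least: "\<And>p u. p \<in> I \<Longrightarrow> u \<in> keys p \<Longrightarrow> pp_deg u0 \<le> pp_deg u"
  shows "quot_dim (tensor_cycles F 0 (int (pp_deg u0))) (tensor_boundaries F 0 (int (pp_deg u0))) \<noteq> 0"
proof -
  interpret aug_res n I "aug_basis F" "aug_deg F" "aug_bdry F" by (rule aug_res_of_resolution[OF F])
  let ?j = "int (pp_deg u0)"
  \<comment> \<open>Basis elements with nonzero augmentation have degree at least \<open>?j\<close>,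
    so their coefficients in an element of degree \<open>?j\<close> are constants.\<close>
  have aug0: "aug_map F v = aug_map F (const_lift (const_part v))" if v: "v \<in> hom_mod n (basis F 0) (bdeg F 0) ?j" for v
  proof -
    have *: "lookup v b * aug F b = lookup (const_lift (const_part v)) b * aug F b" for b
    proof (cases "lookup v b = 0 \<or> aug F b = 0")
      case False
      then obtain a where a: "a \<in> keys (aug F b)" using keys_eq_empty by fastforce
      have "b \<in> basis F 0"
        using hom_mod_free[OF v] False by (auto simp: free_mod_def in_keys_iff)
      then have "aug F b \<in> I"
      proof -
        have "single b 1 \<in> free_mod n (basis F 0)" using \<open>b \<in> basis F 0\<close>
          by (auto simp: free_mod_iff in_keys_iff lookup_single when_def lookup_one split: if_splits)
        moreover have "aug_map F (single b 1) = aug F b" by (simp add: aug_map_def)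
        moreover have "aug_map F ` free_mod n (basis F 0) = I" using F by (simp add: graded_free_resolution_def)
        ultimately show ?thesis by (metis image_eqI)
      qed
      from least[OF this a] have "?j \<le> bdeg F 0 b"
        using F \<open>b \<in> basis F 0\<close> a by (fastforce simp: graded_free_resolution_def)
      then have "u = 0" if "u \<in> keys (lookup v b)" for u
      proof -
        have "pp_deg u = 0" using hom_mod_deg[OF v that] \<open>?j \<le> bdeg F 0 b\<close> by linarith
        then show ?thesis by simp
      qed
      then have "lookup v b = single 0 (lookup (lookup v b) 0)"
        by (intro poly_mapping_eqI) (auto simp: lookup_single when_def in_keys_iff)
      then show ?thesis by simp
    qed auto
    have k: "keys (const_lift (const_part v)) \<subseteq> keys v" by (auto simp: in_keys_iff)
    have "aug_map F v = (\<Sum>b\<in>keys v. lookup (const_lift (const_part v)) b * aug F b)"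
      unfolding aug_map_def by (intro sum.cong refl *)
    also have "\<dots> = aug_map F (const_lift (const_part v))"
      unfolding aug_map_def using k by (intro sum.mono_neutral_right) (auto simp: in_keys_iff)
    finally show ?thesis .
  qed
  have "single 0 (mon u0) \<in> hom_mod n (aug_basis F 0) (aug_deg F 0) ?j"
    using u0 by (auto simp: hom_mod_iff lookup_single when_def split: if_splits)
  from hom_exact0[OF this] u0 obtain w where w: "w \<in> hom_mod n (basis F 0) (bdeg F 0) ?j"
    "aug_map F w = mon u0" by (auto simp: lin_map_aug single_inj)
  show ?thesis
  proof (rule quot_dim_neq_0)
    show "const_part w \<in> tensor_cycles F 0 ?j" using const_part_hom_mod[OF w(1)] by (simp add: tensor_cycles_def)
    fix c assume "smult c (const_part w) \<in> tensor_boundaries F 0 ?j"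
    then obtain x where x: "x \<in> tensor_chains F (Suc 0) ?j" "smult c (const_part w) = tensor_bdry F 0 x"
      by (auto simp: tensor_boundaries_def)
    have lx: "const_lift x \<in> hom_mod n (aug_basis F (Suc (Suc 0))) (aug_deg F (Suc (Suc 0))) ?j" using const_lift_hom_mod[OF x(1)] by simp
    let ?v = "bdry_map F 0 (const_lift x)"
    have v: "?v \<in> hom_mod n (basis F 0) (bdeg F 0) ?j"
      using lin_map_D_hom[OF lx] by (simp add: bdry_map_lin_map)
    have v0: "aug_map F ?v = 0"
      using lin_map_lin_map[OF lx] single_inj[of 0 "aug_map F ?v" 0] by (simp add: bdry_map_lin_map lin_map_aug)
    \<comment> \<open>\<open>?v\<close> and the c-fold of \<open>w\<close> have the same constant
      part, hence the same augmentation: 0 for one and c times \<open>u0\<close> for the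
      other.\<close>
    have "const_part ?v = const_part (smult (single 0 c) w)" unfolding const_part_bdry_map const_part_const_lift x(2)[symmetric]
      by (rule poly_mapping_eqI) (simp add: lookup_mult_0)
    moreover have "smult (single 0 c) w \<in> hom_mod n (basis F 0) (bdeg F 0) (0 + ?j)"
      using w(1) by (rule hom_mod_smult) (auto split: if_splits)
    ultimately have "aug_map F (smult (single 0 c) w) = 0" using aug0[OF v] aug0 v0 by simp
    moreover have "single 0 (aug_map F (smult (single 0 c) w)) = smult (single 0 c) (single (0::nat) (mon u0))"
      unfolding lin_map_aug[symmetric] lin_map_smult unfolding lin_map_aug w(2) ..
    then have "aug_map F (smult (single 0 c) w) = single 0 c * mon u0"
      by (metis lookup_single_eq lookup_smult)
    ultimately have "single u0 c = 0" by (simp add: mult_single)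
    then show "c = 0" by (metis lookup_single_eq lookup_zero)
  qed
qed

section \<open>Existence of resolutions\<close>

definition lcm_label :: "(nat \<Rightarrow> pp) \<Rightarrow> nat set \<Rightarrow> pp" where
  "lcm_label g T = Abs_poly_mapping (\<lambda>i. Max (insert 0 ((\<lambda>t. lookup (g t) i) ` T)))"

lemma lookup_lcm_label:
  assumes "finite T"
  shows "lookup (lcm_label g T) i = Max (insert 0 ((\<lambda>t. lookup (g t) i) ` T))"
  unfolding lcm_label_def
proof (rule fun_cong[OF lookup_Abs_poly_mapping])
  have "{i. Max (insert 0 ((\<lambda>t. lookup (g t) i) ` T)) \<noteq> 0} \<subseteq> (\<Union>t\<in>T. keys (g t))"
  proof
    fix i assume "i \<in> {i. Max (insert 0 ((\<lambda>t. lookup (g t) i) ` T)) \<noteq> 0}"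
    moreover have "Max (insert 0 ((\<lambda>t. lookup (g t) i) ` T)) \<in> insert 0 ((\<lambda>t. lookup (g t) i) ` T)"
      using assms by (intro Max_in) auto
    ultimately show "i \<in> (\<Union>t\<in>T. keys (g t))" by (auto simp: in_keys_iff)
  qed
  then show "finite {i. Max (insert 0 ((\<lambda>t. lookup (g t) i) ` T)) \<noteq> 0}"
    by (rule finite_subset) (use assms in auto)
qed

lemma lcm_label_adds_iff: "finite T \<Longrightarrow> lcm_label g T adds u \<longleftrightarrow> (\<forall>t\<in>T. g t adds u)"
  by (auto simp: adds_pp_def lookup_lcm_label)
lemma lcm_label_empty [simp]: "lcm_label g {} = 0"
  by (rule poly_mapping_eqI) (simp add: lookup_lcm_label)
lemma lcm_label_sing [simp]: "lcm_label g {t} = g t"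
  by (rule poly_mapping_eqI) (simp add: lookup_lcm_label)
lemma lcm_label_mono: "finite U \<Longrightarrow> T \<subseteq> U \<Longrightarrow> lcm_label g T adds lcm_label g U"
  using lcm_label_adds_iff[of U g "lcm_label g U"] finite_subset[of T U] by (auto simp: lcm_label_adds_iff)
lemma lcm_label_monomials:
  assumes "finite T" "\<And>t. t \<in> T \<Longrightarrow> g t \<in> monomials n"
  shows "lcm_label g T \<in> monomials n"
proof -
  have "lcm_label g T adds (\<Sum>t\<in>T. g t)"
    unfolding lcm_label_adds_iff[OF assms(1)] using assms(1) by (auto simp: adds_iff_ex sum.remove)
  moreover have "(\<Sum>t\<in>T. g t) \<in> monomials n"
    using assms by (induction T rule: finite_induct) auto
  ultimately show ?thesis by (rule monomials_adds)
qed
lemma mono_label_lcm_label: "finite R \<Longrightarrow> mono_label (lcm_label g) R"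
  unfolding mono_label_def by (intro allI impI lcm_label_mono) (auto intro: finite_subset)

lemma lin_map_free_mod:
  assumes "\<And>b. b \<in> B' \<Longrightarrow> D b \<in> free_mod n B" "v \<in> free_mod n B'"
  shows "lin_map D v \<in> free_mod n B"
  unfolding free_mod_iff
proof (intro allI impI)
  fix c u assume "u \<in> keys (lookup (lin_map D v) c)"
  then obtain b where b: "b \<in> keys v" "u \<in> keys (lookup v b * lookup (D b) c)"
    unfolding lookup_lin_map[OF finite_keys order_refl] by (rule keys_sum_ex)
  then obtain x y where "x \<in> keys (lookup v b)" "y \<in> keys (lookup (D b) c)" "u = x + y" by (blast elim: keys_mult_ex)
  moreover from this have "b \<in> B'" "x \<in> monomials n" using assms(2) by (auto simp: free_mod_iff)
  ultimately show "c \<in> B \<and> u \<in> monomials n" using assms(1) by (auto simp: free_mod_iff)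
qed

section \<open>Taylor's resolution of a monomial ideal\<close>

locale taylor =
  fixes n :: nat and r :: nat and g :: "nat \<Rightarrow> pp" and I :: "'k::field mpoly set"
  assumes g: "\<And>t. t < r \<Longrightarrow> g t \<in> monomials n"
    and I: "I = {p. keys p \<subseteq> monomials n \<and> (\<forall>u\<in>keys p. \<exists>t<r. g t adds u)}"
begin

abbreviation R :: "nat set" where "R \<equiv> {..<r}"
abbreviation L :: "nat set \<Rightarrow> pp" where "L \<equiv> lcm_label g"

text \<open>Bases are labelled by natural numbers, so sets of generators are encoded by
  \<open>set_encode\<close>. The singletons index the basis of F_0 and the empty set stands for S
  itself, whence the \<open>Suc\<close> in \<open>tcomplex\<close>.\<close>

definition tbasis :: "nat \<Rightarrow> nat set" where
  "tbasis q = set_encode ` {T. T \<subseteq> R \<and> card T = q}"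
definition tbdry :: "nat \<Rightarrow> nat \<Rightarrow>\<^sub>0 'k mpoly" where
  "tbdry b = (\<Sum>t\<in>set_decode b. single (set_encode (set_decode b - {t}))
     (single (L (set_decode b) - L (set_decode b - {t})) (face_sign t (set_decode b - {t}))))"
definition tcomplex :: "'k free_complex" where
  "tcomplex = \<lparr>basis = \<lambda>p. tbasis (Suc p), bdeg = \<lambda>p b. int (pp_deg (L (set_decode b))),
     aug = \<lambda>b. single (L (set_decode b)) 1, bdry = \<lambda>p. tbdry\<rparr>"

text \<open>Goes back from encoded labels to functions on sets, the form in which
  \<open>taylor_exact\<close> applies.\<close>

definition coeff_chain :: "(nat \<Rightarrow>\<^sub>0 'k mpoly) \<Rightarrow> nat set \<Rightarrow> 'k mpoly" where
  "coeff_chain v T = (if T \<subseteq> R then lookup v (set_encode T) else 0)"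

lemma finite_subset_R: "T \<subseteq> R \<Longrightarrow> finite T" by (rule finite_subset) auto

lemma mono_label_L: "mono_label L R" by (rule mono_label_lcm_label) simp

lemma L_monomials: "T \<subseteq> R \<Longrightarrow> L T \<in> monomials n"
  using finite_subset_R g by (intro lcm_label_monomials) auto

lemma tbasis_iff: "b \<in> tbasis q \<longleftrightarrow> set_decode b \<subseteq> R \<and> card (set_decode b) = q"
  unfolding tbasis_def using finite_subset_R by (force simp: set_encode_inverse intro: image_eqI[of _ _ "set_decode b"])

lemma encode_tbasis: "T \<subseteq> R \<Longrightarrow> set_encode T \<in> tbasis q \<longleftrightarrow> card T = q"
  using finite_subset_R by (simp add: tbasis_iff set_encode_inverse)

lemma taylor_diff_cong: "T \<subseteq> R \<Longrightarrow> (\<And>U. U \<subseteq> R \<Longrightarrow> f U = h U) \<Longrightarrow> taylor_diff L R f T = taylor_diff L R h T"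
  unfolding taylor_diff_def by (intro sum.cong) auto

lemma coeff_chain_supp: "v \<in> free_mod n (tbasis q) \<Longrightarrow> coeff_chain v T \<noteq> 0 \<Longrightarrow> T \<subseteq> R \<and> card T = q"
  using encode_tbasis[of T q] by (auto simp: coeff_chain_def free_mod_def in_keys_iff split: if_splits)

lemma coeff_chain_keys: "v \<in> free_mod n (tbasis q) \<Longrightarrow> u \<in> keys (coeff_chain v T) \<Longrightarrow> u \<in> monomials n"
  by (auto simp: coeff_chain_def free_mod_iff split: if_splits)

text \<open>Singletons are labelled by the generators and the empty set by 1, so the augmentation is
  the Taylor differential at the empty face.\<close>

lemma aug_taylor_diff:
  assumes v: "v \<in> free_mod n (tbasis 1)"
  shows "aug_map tcomplex v = taylor_diff L R (coeff_chain v) {}"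
proof -
  have inj: "inj_on (\<lambda>t. set_encode {t}) R"
    by (auto simp: inj_on_def)
  have "keys v \<subseteq> (\<lambda>t. set_encode {t}) ` R"
  proof
    fix b assume "b \<in> keys v"
    then have "b \<in> tbasis 1" using v by (auto simp: free_mod_def)
    then obtain t where "set_decode b = {t}" "t \<in> R" unfolding tbasis_iff by (auto simp: card_1_singleton_iff)
    then show "b \<in> (\<lambda>t. set_encode {t}) ` R" by (metis image_eqI set_decode_inverse)
  qed
  then have "aug_map tcomplex v = (\<Sum>b\<in>(\<lambda>t. set_encode {t}) ` R. lookup v b * single (L (set_decode b)) 1)"
    unfolding aug_map_def by (intro sum.mono_neutral_cong_left) (auto simp: tcomplex_def in_keys_iff)
  also have "\<dots> = (\<Sum>t\<in>R. lookup v (set_encode {t}) * single (g t) 1)"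
  proof -
    have "set_decode (set_encode {t}) = {t}" for t by (rule set_encode_inverse) simp
    then show ?thesis by (simp only: sum.reindex[OF inj] o_def lcm_label_sing)
  qed
  also have "\<dots> = taylor_diff L R (coeff_chain v) {}"
    by (auto simp: taylor_diff_def coeff_chain_def face_sign_def mult.commute intro!: sum.cong)
  finally show ?thesis .
qed

lemma lookup_tbdry:
  assumes "b \<in> tbasis q"
  shows "lookup (tbdry b) c = (\<Sum>t\<in>set_decode b. if set_decode b - {t} = set_decode c
     then single (L (set_decode b) - L (set_decode c)) (face_sign t (set_decode c)) else 0)"
proof -
  have "finite (set_decode b - {t})" for t by simp
  then have "set_encode (set_decode b - {t}) = c \<longleftrightarrow> set_decode b - {t} = set_decode c" for t
    by (metis set_decode_inverse set_encode_inverse)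
  then show ?thesis unfolding tbdry_def lookup_sum
    by (intro sum.cong refl) (auto simp: lookup_single when_def)
qed

text \<open>\<open>tbdry\<close> runs through the facets of a given set, \<open>taylor_diff\<close>
  through the sets of which a given one is a facet; both sums range over the same pairs of a set T
  and a vertex t of T.\<close>

lemma bdry_taylor_diff:
  assumes v: "v \<in> free_mod n (tbasis q)"
  shows "lookup (bdry_map tcomplex p v) c = (if set_decode c \<subseteq> R then taylor_diff L R (coeff_chain v) (set_decode c) else 0)"
proof -
  let ?C = "set_decode c"
  let ?m = "\<lambda>T t. single (L T - L ?C) (face_sign t ?C) :: 'k mpoly"
  have kv: "keys v \<subseteq> tbasis q" using v by (auto simp: free_mod_def)
  have k: "keys v \<subseteq> set_encode ` Pow R" using kv by (auto simp: tbasis_def)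
  have inj: "inj_on set_encode (Pow R)" using finite_subset_R by (auto intro: inj_on_subset[OF inj_on_set_encode])
  have "lookup (bdry_map tcomplex p v) c = (\<Sum>b\<in>keys v. lookup v b * lookup (tbdry b) c)"
    by (simp add: bdry_map_lin_map lookup_lin_map[of "keys v"] tcomplex_def)
  also have "\<dots> = (\<Sum>b\<in>keys v. lookup v b * (\<Sum>t\<in>set_decode b. if set_decode b - {t} = ?C then ?m (set_decode b) t else 0))"
    using lookup_tbdry kv by (intro sum.cong refl) auto
  also have "\<dots> = (\<Sum>b\<in>set_encode ` Pow R. lookup v b * (\<Sum>t\<in>set_decode b. if set_decode b - {t} = ?C then ?m (set_decode b) t else 0))"
    using k by (intro sum.mono_neutral_left) (auto simp: in_keys_iff)
  also have "\<dots> = (\<Sum>T\<in>Pow R. lookup v (set_encode T) * (\<Sum>t\<in>T. if T - {t} = ?C then ?m T t else 0))"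
    unfolding sum.reindex[OF inj] o_def
    by (intro sum.cong refl) (simp only: Pow_iff finite_subset_R set_encode_inverse)
  also have "\<dots> = (\<Sum>T\<in>Pow R. \<Sum>t\<in>T. if T - {t} = ?C then lookup v (set_encode T) * ?m T t else 0)"
    by (simp add: sum_distrib_left if_distrib cong: if_cong)
  also have "\<dots> = (\<Sum>(T,t)\<in>Sigma (Pow R) (\<lambda>T. T). if T - {t} = ?C then lookup v (set_encode T) * ?m T t else 0)"
    using finite_subset_R by (intro sum.Sigma) auto
  also have "\<dots> = (\<Sum>(T,t)\<in>{(T,t). T \<subseteq> R \<and> t \<in> T \<and> T - {t} = ?C}. lookup v (set_encode T) * ?m T t)"
    using finite_subset_R by (intro sum.mono_neutral_cong_right finite_SigmaI) (auto split: if_splits)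
  also have "\<dots> = (if ?C \<subseteq> R then taylor_diff L R (coeff_chain v) ?C else 0)"
  proof (cases "?C \<subseteq> R")
    case True
    have ins: "T = insert t ?C \<and> t \<notin> ?C" if "T - {t} = ?C" "t \<in> T" for T t
      using that by auto
    have "(\<Sum>(T,t)\<in>{(T,t). T \<subseteq> R \<and> t \<in> T \<and> T - {t} = ?C}. lookup v (set_encode T) * ?m T t)
      = (\<Sum>t\<in>R - ?C. lookup v (set_encode (insert t ?C)) * ?m (insert t ?C) t)"
      using True by (intro sum.reindex_bij_witness[of _ "\<lambda>t. (insert t ?C, t)" snd]) (auto dest: ins)
    then show ?thesis using True by (auto simp: taylor_diff_def coeff_chain_def mult.commute intro!: sum.cong)
  next
    case False
    then have "{(T,t). T \<subseteq> R \<and> t \<in> T \<and> T - {t} = ?C} = {}" by auto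
    then show ?thesis using False by (simp only: sum.empty if_False)
  qed
  finally show ?thesis .
qed

lemma tbdry_hom:
  assumes b: "b \<in> tbasis (Suc q)"
  shows "tbdry b \<in> hom_mod n (tbasis q) (\<lambda>b. int (pp_deg (L (set_decode b)))) (int (pp_deg (L (set_decode b))))"
  unfolding hom_mod_iff
proof (intro allI impI)
  fix c u assume "u \<in> keys (lookup (tbdry b) c)"
  then obtain t where t: "t \<in> set_decode b" "set_decode b - {t} = set_decode c"
    "u \<in> keys (single (L (set_decode b) - L (set_decode c)) (face_sign t (set_decode c)) :: 'k mpoly)"
    unfolding lookup_tbdry[OF b] by (auto elim!: keys_sum_ex split: if_splits)
  then have u: "u = L (set_decode b) - L (set_decode c)" by (auto split: if_splits)
  have "L (set_decode c) adds L (set_decode b)" using t(2) by (intro lcm_label_mono) auto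
  then have eq: "u + L (set_decode c) = L (set_decode b)" by (simp add: u adds_diff_add)
  have bR: "set_decode b \<subseteq> R" "card (set_decode b) = Suc q" using b by (auto simp: tbasis_iff)
  have "c \<in> tbasis q" using t(1) t(2)[symmetric] bR by (auto simp: tbasis_iff)
  moreover have "u \<in> monomials n" using L_monomials[OF bR(1)] by (metis eq monomials_add)
  moreover have "pp_deg u + pp_deg (L (set_decode c)) = pp_deg (L (set_decode b))"
    by (metis eq pp_deg_add)
  ultimately show "c \<in> tbasis q \<and> u \<in> monomials n \<and>
    int (pp_deg u) + int (pp_deg (L (set_decode c))) = int (pp_deg (L (set_decode b)))" by simp
qed

text \<open>A generator dividing the multidegree is an apex. At a nonempty face the existence of one
  is clear, since every vertex qualifies; at the empty face the monomial itself must lie in the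
  ideal, which is \<open>low\<close>.\<close>

lemma taylor_fill:
  assumes supp: "\<And>T. f T \<noteq> 0 \<Longrightarrow> T \<subseteq> R \<and> card T = q"
    and mono: "\<And>T u. u \<in> keys (f T) \<Longrightarrow> u \<in> monomials n"
    and cyc: "\<And>T. T \<subseteq> R \<Longrightarrow> taylor_diff L R f T = 0"
    and low: "\<And>u. q = 0 \<Longrightarrow> u \<in> keys (f {}) \<Longrightarrow> \<exists>t\<in>R. g t adds u"
  obtains w where "w \<in> free_mod n (tbasis (Suc q))" "\<And>T. T \<subseteq> R \<Longrightarrow> taylor_diff L R (coeff_chain w) T = f T"
proof -
  define \<kappa> where "\<kappa> a = (SOME t. t \<in> R \<and> g t adds a)" for a
  have apex: "\<kappa> (L T + u) \<in> R \<and> L (insert (\<kappa> (L T + u)) T) adds L T + u"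
    if T: "T \<subseteq> R" and u: "u \<in> keys (f T)" for T u
  proof -
    have "f T \<noteq> 0" using u by auto
    then have c: "card T = q" using supp by blast
    have LT: "g t adds L T + u" if "t \<in> T" for t
      using lcm_label_adds_iff[OF finite_subset_R[OF T], of g "L T"] that by (auto intro: adds_addI)
    have "\<exists>t. t \<in> R \<and> g t adds L T + u"
    proof (cases "T = {}")
      case True
      then show ?thesis using low[of u] c u by auto
    next
      case False
      then show ?thesis using LT T by blast
    qed
    then have "\<kappa> (L T + u) \<in> R \<and> g (\<kappa> (L T + u)) adds L T + u" unfolding \<kappa>_def by (rule someI_ex)
    then show ?thesis using LT finite_subset_R[OF T] by (simp add: lcm_label_adds_iff)
  qed
  have supp': "T \<subseteq> R" if "f T \<noteq> 0" for T using supp that by blast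
  obtain h where h: "\<And>T. h T \<noteq> 0 \<Longrightarrow> T \<subseteq> R" "\<And>T. T \<subseteq> R \<Longrightarrow> taylor_diff L R h T = f T"
    "\<And>T u. u \<in> keys (h T) \<Longrightarrow> \<exists>k w. k = \<kappa> (L T + u) \<and> k \<in> T \<and> w \<in> keys (f (T - {k})) \<and> L (T - {k}) + w = L T + u"
  proof (rule taylor_exact[OF mono_label_L finite_lessThan supp' cyc apex], assumption+)
  qed (rule that, assumption+)
  define w where "w = (\<Sum>T\<in>Pow R. single (set_encode T) (h T))"
  have lw: "lookup w (set_encode T) = h T" if "T \<subseteq> R" for T
  proof -
    have "lookup w (set_encode T) = (\<Sum>U\<in>Pow R. if U = T then h T else 0)"
      unfolding w_def lookup_sum
    proof (intro sum.cong refl)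
      fix U assume "U \<in> Pow R"
      then show "lookup (single (set_encode U) (h U)) (set_encode T) = (if U = T then h T else 0)"
        using set_encode_eq[OF finite_subset_R finite_subset_R, of U T] that by (auto simp: lookup_single when_def)
    qed
    then show ?thesis using that by simp
  qed
  have lw0: "set_decode b \<subseteq> R" if "lookup w b \<noteq> 0" for b
  proof -
    have "\<exists>U\<in>Pow R. lookup (single (set_encode U) (h U)) b \<noteq> 0"
      using that unfolding w_def lookup_sum by (meson sum.not_neutral_contains_not_neutral)
    then show ?thesis using finite_subset_R by (auto simp: lookup_single when_def set_encode_inverse split: if_splits)
  qed
  have "w \<in> free_mod n (tbasis (Suc q))"
    unfolding free_mod_iff
  proof (intro allI impI)
    fix b u assume u: "u \<in> keys (lookup w b)"
    let ?T = "set_decode b"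
    have T: "?T \<subseteq> R" using u by (intro lw0) auto
    then have "u \<in> keys (h ?T)" using lw[OF T] u by simp
    from h(3)[OF this] obtain k x where kx: "k \<in> ?T" "x \<in> keys (f (?T - {k}))" "L (?T - {k}) + x = L ?T + u" by blast
    have "f (?T - {k}) \<noteq> 0" using kx(2) by auto
    then have "card (?T - {k}) = q" using supp by blast
    then have "card ?T = Suc q" using kx(1) by (metis card.remove finite_set_decode)
    moreover have "L (?T - {k}) \<in> monomials n" using T by (intro L_monomials) auto
    then have "L ?T + u \<in> monomials n" using mono[OF kx(2)] unfolding kx(3)[symmetric] by simp
    ultimately show "b \<in> tbasis (Suc q) \<and> u \<in> monomials n" using T by (simp add: tbasis_iff)
  qed
  moreover have "taylor_diff L R (coeff_chain w) T = f T" if "T \<subseteq> R" for T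
    using h(2)[OF that] taylor_diff_cong[OF that, of "coeff_chain w" h] lw by (simp add: coeff_chain_def)
  ultimately show ?thesis by (rule that)
qed

lemma bdry_free: "v \<in> free_mod n (tbasis (Suc q)) \<Longrightarrow> bdry_map tcomplex p v \<in> free_mod n (tbasis q)"
  unfolding bdry_map_lin_map tcomplex_def by (auto intro!: lin_map_free_mod hom_mod_free[OF tbdry_hom])

lemma coeff_chain_bdry: "v \<in> free_mod n (tbasis q) \<Longrightarrow> T \<subseteq> R \<Longrightarrow> coeff_chain (bdry_map tcomplex p v) T = taylor_diff L R (coeff_chain v) T"
  using bdry_taylor_diff finite_subset_R by (simp add: coeff_chain_def set_encode_inverse)

lemma taylor_diff_bdry:
  assumes "v \<in> free_mod n (tbasis q)" "T \<subseteq> R"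
  shows "taylor_diff L R (coeff_chain (bdry_map tcomplex p v)) T = 0"
  using taylor_diff_cong[OF assms(2) coeff_chain_bdry[OF assms(1)]] taylor_diff_taylor_diff[OF mono_label_L _ assms(2)] by simp

lemma taylor_preimage:
  assumes v: "v \<in> free_mod n (tbasis (Suc q))" and 0: "\<And>T. T \<subseteq> R \<Longrightarrow> taylor_diff L R (coeff_chain v) T = 0"
  shows "v \<in> bdry_map tcomplex p ` free_mod n (tbasis (Suc (Suc q)))"
proof -
  obtain w where w: "w \<in> free_mod n (tbasis (Suc (Suc q)))" "\<And>T. T \<subseteq> R \<Longrightarrow> taylor_diff L R (coeff_chain w) T = coeff_chain v T"
    by (rule taylor_fill[of "coeff_chain v" "Suc q"]) (use coeff_chain_supp[OF v] coeff_chain_keys[OF v] 0 in auto)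
  have "v = bdry_map tcomplex p w"
  proof (rule poly_mapping_eqI)
    fix c
    show "lookup v c = lookup (bdry_map tcomplex p w) c"
    proof (cases "set_decode c \<subseteq> R")
      case True
      then show ?thesis using bdry_taylor_diff[OF w(1)] w(2) by (simp add: coeff_chain_def)
    next
      case False
      then have "c \<notin> tbasis (Suc q)" by (simp add: tbasis_iff)
      then have "c \<notin> keys v" using v by (auto simp: free_mod_def)
      then show ?thesis using False bdry_taylor_diff[OF w(1)] by (simp add: in_keys_iff)
    qed
  qed
  then show ?thesis using w(1) by blast
qed

lemma tcomplex_resolution: "graded_free_resolution n I tcomplex"
proof -
  have sel: "basis tcomplex p = tbasis (Suc p)" "bdeg tcomplex p b = int (pp_deg (L (set_decode b)))"
    "aug tcomplex b = single (L (set_decode b)) 1" "bdry tcomplex p = tbdry" for p b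
    by (simp_all add: tcomplex_def)
  have 1: "aug tcomplex b \<in> carrier (poly_ring n) \<and> (\<forall>u \<in> keys (aug tcomplex b). int (pp_deg u) = bdeg tcomplex 0 b)"
    if "b \<in> basis tcomplex 0" for b
    using that L_monomials by (auto simp: sel tbasis_iff)
  have 2: "bdry tcomplex i b \<in> free_mod n (basis tcomplex i) \<and>
        (\<forall>c. \<forall>u \<in> keys (lookup (bdry tcomplex i b) c). int (pp_deg u) + bdeg tcomplex i c = bdeg tcomplex (Suc i) b)"
    if "b \<in> basis tcomplex (Suc i)" for i b
    using tbdry_hom[of b "Suc i"] that unfolding hom_mod_def sel by simp
  \<comment> \<open>\<open>v\<close> lives on singletons, so its differential can be nonzero only at
    the empty face, and being a cycle amounts to having augmentation zero.\<close>
  have aug0: "taylor_diff L R (coeff_chain v) T = 0" if "v \<in> free_mod n (tbasis 1)" "T \<noteq> {}" "T \<subseteq> R" for v T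
  proof -
    have "card (insert t T) \<noteq> 1" if "t \<notin> T" for t
      using \<open>T \<noteq> {}\<close> that finite_subset_R[OF \<open>T \<subseteq> R\<close>] by auto
    then have "coeff_chain v (insert t T) = 0" if "t \<notin> T" for t using coeff_chain_supp[OF \<open>v \<in> _\<close>] that by blast
    then show ?thesis by (auto simp: taylor_diff_def intro!: sum.neutral)
  qed
  have 3: "aug_map tcomplex ` free_mod n (tbasis 1) = I"
  proof (intro equalityI subsetI)
    fix p assume "p \<in> aug_map tcomplex ` free_mod n (tbasis 1)"
    then obtain v where v: "v \<in> free_mod n (tbasis 1)" "p = taylor_diff L R (coeff_chain v) {}" using aug_taylor_diff by auto
    have "u \<in> monomials n \<and> (\<exists>t<r. g t adds u)" if "u \<in> keys p" for u
    proof -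
      have "u \<in> keys (\<Sum>t\<in>R - {}. single (L (insert t {}) - L {}) (face_sign t {}) * coeff_chain v (insert t {}))"
        using that unfolding v(2) taylor_diff_def .
      then obtain t where "t \<in> R - {}" "u \<in> keys (single (L (insert t {}) - L {}) (face_sign t {}) * coeff_chain v (insert t {}))"
        by (rule keys_sum_ex)
      then have t: "t \<in> R" "u \<in> keys (single (g t) (face_sign t {}) * coeff_chain v {t})" by simp_all
      then obtain x y where "x \<in> keys (single (g t) (face_sign t {}) :: 'k mpoly)" "y \<in> keys (coeff_chain v {t})" "u = x + y"
        by (blast elim: keys_mult_ex)
      then have "u = g t + y" "y \<in> monomials n" using coeff_chain_keys[OF v(1)] by (auto split: if_splits)
      then show ?thesis using t(1) g by auto
    qed
    then show "p \<in> I" unfolding I by blast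
  next
    fix p assume p: "p \<in> I"
    \<comment> \<open>A polynomial in \<open>I\<close> is regarded as a chain on the empty face, to
      be filled by a chain on singletons.\<close>
    define f where "f T = (if T = {} then p else 0)" for T :: "nat set"
    obtain w where w: "w \<in> free_mod n (tbasis (Suc 0))" "\<And>T. T \<subseteq> R \<Longrightarrow> taylor_diff L R (coeff_chain w) T = f T"
      by (rule taylor_fill[of f 0]) (use p in \<open>auto simp: f_def I taylor_diff_def split: if_splits\<close>)
    then have "aug_map tcomplex w = p" using aug_taylor_diff[of w] by (simp add: f_def)
    then show "p \<in> aug_map tcomplex ` free_mod n (tbasis 1)" using w(1) by auto
  qed
  have 4: "{v \<in> free_mod n (tbasis 1). aug_map tcomplex v = 0} = bdry_map tcomplex 0 ` free_mod n (tbasis 2)"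
  proof (intro equalityI subsetI)
    fix v assume "v \<in> {v \<in> free_mod n (tbasis 1). aug_map tcomplex v = 0}"
    then have v: "v \<in> free_mod n (tbasis (Suc 0))" "taylor_diff L R (coeff_chain v) {} = 0" using aug_taylor_diff[of v] by auto
    then have "taylor_diff L R (coeff_chain v) T = 0" if "T \<subseteq> R" for T using aug0[of v T] that by auto
    from taylor_preimage[OF v(1) this] show "v \<in> bdry_map tcomplex 0 ` free_mod n (tbasis 2)"
      by (simp add: numeral_2_eq_2)
  next
    fix v assume "v \<in> bdry_map tcomplex 0 ` free_mod n (tbasis 2)"
    then obtain w where w: "w \<in> free_mod n (tbasis (Suc 1))" "v = bdry_map tcomplex 0 w"
      by (auto simp: numeral_2_eq_2)
    then have "v \<in> free_mod n (tbasis 1)" using bdry_free by blast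
    moreover from this have "aug_map tcomplex v = 0" using aug_taylor_diff taylor_diff_bdry[OF w(1), of "{}" 0] w(2) by simp
    ultimately show "v \<in> {v \<in> free_mod n (tbasis 1). aug_map tcomplex v = 0}" by blast
  qed
  have 5: "{v \<in> free_mod n (tbasis (Suc (Suc i))). bdry_map tcomplex i v = 0} = bdry_map tcomplex (Suc i) ` free_mod n (tbasis (Suc (Suc (Suc i))))" for i
  proof (intro equalityI subsetI)
    fix v assume "v \<in> {v \<in> free_mod n (tbasis (Suc (Suc i))). bdry_map tcomplex i v = 0}"
    then have v: "v \<in> free_mod n (tbasis (Suc (Suc i)))" "bdry_map tcomplex i v = 0" by auto
    have "taylor_diff L R (coeff_chain v) T = 0" if "T \<subseteq> R" for T
      unfolding coeff_chain_bdry[OF v(1) that, of i, symmetric] v(2) by (simp add: coeff_chain_def)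
    from taylor_preimage[OF v(1) this] show "v \<in> bdry_map tcomplex (Suc i) ` free_mod n (tbasis (Suc (Suc (Suc i))))" .
  next
    fix v assume "v \<in> bdry_map tcomplex (Suc i) ` free_mod n (tbasis (Suc (Suc (Suc i))))"
    then obtain w where w: "w \<in> free_mod n (tbasis (Suc (Suc (Suc i))))" "v = bdry_map tcomplex (Suc i) w" by auto
    then have v: "v \<in> free_mod n (tbasis (Suc (Suc i)))" using bdry_free by blast
    have "bdry_map tcomplex i v = 0"
      by (rule poly_mapping_eqI) (use bdry_taylor_diff[OF v] taylor_diff_bdry[OF w(1)] w(2) in simp)
    with v show "v \<in> {v \<in> free_mod n (tbasis (Suc (Suc i))). bdry_map tcomplex i v = 0}" by blast
  qed
  show ?thesis unfolding graded_free_resolution_def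
    using 1 2 3 4 5 by (simp add: sel(1) numeral_2_eq_2)
qed

end

section \<open>Monomial ideals\<close>

lemma poly_ring_sel [simp]:
  "mult (poly_ring n) = (*)" "one (poly_ring n) = 1" "zero (poly_ring n) = 0" "add (poly_ring n) = (+)"
  by (simp_all add: poly_ring_def)

lemma cring_poly_ring: "cring (poly_ring n :: 'k::field mpoly ring)"
proof (rule cringI)
  show "abelian_group (poly_ring n :: 'k mpoly ring)"
  proof (rule abelian_groupI)
    fix x :: "'k mpoly" assume "x \<in> carrier (poly_ring n)"
    then have "- x \<in> carrier (poly_ring n)" by (simp add: in_keys_iff subset_iff)
    then show "\<exists>y\<in>carrier (poly_ring n). y \<oplus>\<^bsub>poly_ring n\<^esub> x = \<zero>\<^bsub>poly_ring n\<^esub>"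
      by (intro bexI[of _ "- x"]) simp_all
  qed (simp_all add: keys_add_sub ac_simps)
  show "comm_monoid (poly_ring n :: 'k mpoly ring)"
    by (rule comm_monoidI) (simp_all add: keys_mult_monomials ac_simps)
qed (simp add: distrib_right)

lemma ideal_poly_ringI:
  fixes J :: "'k::field mpoly set"
  assumes "J \<subseteq> carrier (poly_ring n)" "0 \<in> J" "\<And>p q. p \<in> J \<Longrightarrow> q \<in> J \<Longrightarrow> p + q \<in> J"
    and mult: "\<And>p q. p \<in> J \<Longrightarrow> q \<in> carrier (poly_ring n) \<Longrightarrow> q * p \<in> J"
  shows "ideal J (poly_ring n)"
proof (rule idealI)
  interpret cring "poly_ring n :: 'k mpoly ring" by (rule cring_poly_ring)
  show "ring (poly_ring n :: 'k mpoly ring)" by (rule ring_axioms)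
  show "subgroup J (add_monoid (poly_ring n))"
  proof (rule add.subgroupI)
    show "J \<subseteq> carrier (poly_ring n)" "J \<noteq> {}" using assms by auto
  next
    fix a assume a: "a \<in> J"
    have "\<ominus>\<^bsub>poly_ring n\<^esub> a = - a"
      using a assms(1) by (intro minus_equality) (auto simp: in_keys_iff subset_iff)
    moreover have "(- 1) * a \<in> J" using a by (intro mult) (auto simp: in_keys_iff lookup_one when_def)
    ultimately show "\<ominus>\<^bsub>poly_ring n\<^esub> a \<in> J" by simp
  qed (use assms in auto)
  show "\<And>a x. a \<in> J \<Longrightarrow> x \<in> carrier (poly_ring n) \<Longrightarrow> x \<otimes>\<^bsub>poly_ring n\<^esub> a \<in> J" using mult by simp
  show "\<And>a x. a \<in> J \<Longrightarrow> x \<in> carrier (poly_ring n) \<Longrightarrow> a \<otimes>\<^bsub>poly_ring n\<^esub> x \<in> J" using mult by (simp add: mult.commute)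
qed

definition mspan :: "nat \<Rightarrow> pp set \<Rightarrow> pp set" where
  "mspan n U = {u \<in> monomials n. \<exists>g\<in>U. g adds u}"

lemma mspan_add: "u \<in> mspan n U \<Longrightarrow> v \<in> monomials n \<Longrightarrow> u + v \<in> mspan n U"
  by (auto simp: mspan_def intro: adds_addI)

lemma ideal_keys:
  assumes "M \<subseteq> monomials n" "\<And>u v. u \<in> M \<Longrightarrow> v \<in> monomials n \<Longrightarrow> u + v \<in> M"
  shows "ideal {p. keys p \<subseteq> M} (poly_ring n :: 'k::field mpoly ring)"
proof (rule ideal_poly_ringI)
  fix p q :: "'k mpoly" assume p: "p \<in> {p. keys p \<subseteq> M}" and q: "q \<in> carrier (poly_ring n)"
  have "keys (q * p) \<subseteq> M"
  proof
    fix u assume "u \<in> keys (q * p)"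
    then obtain x y where "x \<in> keys q" "y \<in> keys p" "u = x + y" by (rule keys_mult_ex)
    then show "u \<in> M" using p q assms(2)[of y x] by (auto simp: add.commute)
  qed
  then show "q * p \<in> {p. keys p \<subseteq> M}" by simp
qed (use assms(1) in \<open>auto intro: keys_add_sub[THEN subsetD]\<close>)

text \<open>Converts ideals into sets of monomials: the right side is an ideal containing the
  generators, and each term of its elements is a multiple of a generator.\<close>

lemma Idl_mon:
  assumes U: "U \<subseteq> monomials n"
  shows "Idl\<^bsub>poly_ring n\<^esub> (mon ` U) = {p :: 'k::field mpoly. keys p \<subseteq> mspan n U}"
proof
  have "ideal {p. keys p \<subseteq> mspan n U} (poly_ring n :: 'k mpoly ring)"
    by (rule ideal_keys) (auto simp: mspan_add, auto simp: mspan_def)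
  moreover have "mon ` U \<subseteq> {p :: 'k mpoly. keys p \<subseteq> mspan n U}"
  proof -
    have "u \<in> mspan n U" if "u \<in> U" for u using U that adds_refl unfolding mspan_def by blast
    then show ?thesis by auto
  qed
  ultimately show "Idl\<^bsub>poly_ring n\<^esub> (mon ` U) \<subseteq> {p :: 'k mpoly. keys p \<subseteq> mspan n U}"
    by (auto simp: genideal_def)
next
  show "{p :: 'k mpoly. keys p \<subseteq> mspan n U} \<subseteq> Idl\<^bsub>poly_ring n\<^esub> (mon ` U)"
  proof (clarsimp simp: genideal_def)
    fix p :: "'k mpoly" and J :: "'k mpoly set" assume p: "keys p \<subseteq> mspan n U" and J: "ideal J (poly_ring n)" and UJ: "mon ` U \<subseteq> J"
    interpret J: ideal J "poly_ring n" by (rule J)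
    have single: "single u (lookup p u) \<in> J" if "u \<in> keys p" for u
    proof -
      have "u \<in> mspan n U" using p that by blast
      then obtain g where g: "g \<in> U" "g adds u" "u \<in> monomials n" by (auto simp: mspan_def)
      have "u - g adds u" by (metis g(2) adds_diff_add adds_add(1))
      then have "u - g \<in> monomials n" using g(3) monomials_adds by blast
      then have "single (u - g) (lookup p u) \<otimes>\<^bsub>poly_ring n\<^esub> mon g \<in> J"
        using g UJ by (intro J.I_l_closed) auto
      then show ?thesis using g(2) by (simp add: mult_single adds_diff_add)
    qed
    have "(\<Sum>u\<in>A. single u (lookup p u)) \<in> J" if "A \<subseteq> keys p" for A
      using finite_subset[OF that finite_keys] that
    proof (induction A rule: finite_induct)
      case empty
      then show ?case using additive_subgroup.zero_closed[OF J.additive_subgroup_axioms] by simp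
    next
      case (insert u A)
      then show ?case using additive_subgroup.a_closed[OF J.additive_subgroup_axioms, of "single u (lookup p u)" "\<Sum>u\<in>A. single u (lookup p u)"] single by simp
    qed
    from this[OF order_refl] show "p \<in> J" by (simp flip: sum_single_keys)
  qed
qed

section \<open>Dickson's lemma\<close>

lemma incseq_subseq_nat:
  fixes a :: "nat \<Rightarrow> nat"
  obtains s where "strict_mono s" "incseq (\<lambda>m. a (s m))"
proof -
  obtain s where s: "strict_mono s" "monoseq (\<lambda>m. a (s m))" using seq_monosub by blast
  show ?thesis
  proof (cases "incseq (\<lambda>m. a (s m))")
    case True
    with s(1) show ?thesis by (rule that)
  next
    case False
    then have dec: "decseq (\<lambda>m. a (s m))" using s(2) by (simp add: monoseq_iff)
    \<comment> \<open>A nonincreasing sequence of naturals is constant once it has reached its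
      minimum.\<close>
    obtain m where m: "\<And>k. a (s m) \<le> a (s k)" using ex_has_least_nat[of "\<lambda>_. True" 0 "\<lambda>m. a (s m)"] by auto
    have "a (s (k + m)) = a (s m)" for k
      using m[of "k + m"] decseqD[OF dec, of m "k + m"] by simp
    then have "incseq (\<lambda>k. a (s (k + m)))" by (simp add: incseq_def)
    moreover have "strict_mono (\<lambda>k. s (k + m))" using s(1) by (simp add: strict_mono_def)
    ultimately show ?thesis by (rule that[rotated])
  qed
qed

text \<open>From an infinite set one extracts a sequence that is nondecreasing in every exponent,
  refining it one variable at a time; its first two members are then comparable.\<close>

lemma dickson:
  assumes A: "A \<subseteq> monomials n" and anti: "\<And>u v. u \<in> A \<Longrightarrow> v \<in> A \<Longrightarrow> u adds v \<Longrightarrow> u = v"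
  shows "finite A"
proof (rule ccontr)
  assume "infinite A"
  then obtain f :: "nat \<Rightarrow> pp" where f: "inj f" "range f \<subseteq> A" by (metis infinite_iff_countable_subset)
  have "\<exists>s. strict_mono s \<and> (\<forall>i\<in>{1..k}. incseq (\<lambda>m. lookup (f (s m)) i))" for k
  proof (induction k)
    case 0
    show ?case by (rule exI[of _ id]) (simp add: strict_mono_def)
  next
    case (Suc k)
    then obtain s where s: "strict_mono s" "\<forall>i\<in>{1..k}. incseq (\<lambda>m. lookup (f (s m)) i)" by blast
    obtain t where t: "strict_mono t" "incseq (\<lambda>m. lookup (f (s (t m))) (Suc k))"
      by (rule incseq_subseq_nat[of "\<lambda>m. lookup (f (s m)) (Suc k)"])
    have "incseq (\<lambda>m. lookup (f (s (t m))) i)" if "i \<in> {1..k}" for i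
      using s(2) that t(1) by (simp add: incseq_def strict_mono_less_eq)
    then have "\<forall>i\<in>{1..Suc k}. incseq (\<lambda>m. lookup (f (s (t m))) i)"
      using t(2) by (auto simp: le_Suc_eq)
    moreover have "strict_mono (\<lambda>m. s (t m))" using s(1) t(1) by (simp add: strict_mono_def)
    ultimately show ?case by blast
  qed
  then obtain s where s: "strict_mono s" "\<forall>i\<in>{1..n}. incseq (\<lambda>m. lookup (f (s m)) i)" by blast
  have "lookup (f (s 0)) i \<le> lookup (f (s 1)) i" for i
  proof (cases "i \<in> {1..n}")
    case True
    then show ?thesis using s(2) incseqD[of _ 0 1] by blast
  next
    case False
    have "f (s 0) \<in> monomials n" using f(2) A by blast
    then have "i \<notin> keys (f (s 0))" using False by (auto simp: monomials_def)
    then show ?thesis by (simp add: in_keys_iff)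
  qed
  then have "f (s 0) adds f (s 1)" by (simp add: adds_pp_def)
  moreover have "f (s 0) \<in> A" "f (s 1) \<in> A" using f(2) by auto
  ultimately have "f (s 0) = f (s 1)" using anti by blast
  then have "s 0 = s 1" using f(1) by (simp add: inj_eq)
  then show False using s(1) by (metis strict_mono_eq zero_neq_one)
qed

locale mon_ideal =
  fixes n :: nat and M :: "pp set" and I :: "'k::field mpoly set"
  assumes M: "M \<subseteq> monomials n"
    and up: "\<And>u v. u \<in> M \<Longrightarrow> v \<in> monomials n \<Longrightarrow> u + v \<in> M"
    and I: "I = {p. keys p \<subseteq> M}"
begin

definition mins :: "pp set" where
  "mins = {u \<in> M. \<forall>v\<in>M. v adds u \<longrightarrow> v = u}"

lemma up_adds: "u \<in> M \<Longrightarrow> u adds v \<Longrightarrow> v \<in> monomials n \<Longrightarrow> v \<in> M"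
  using up by (auto simp: adds_iff_ex)

lemma ex_mins: "u \<in> M \<Longrightarrow> \<exists>g\<in>mins. g adds u"
proof (induction "pp_deg u" arbitrary: u rule: less_induct)
  case less
  show ?case
  proof (cases "u \<in> mins")
    case False
    then obtain v where v: "v \<in> M" "v adds u" "v \<noteq> u" using less.prems by (auto simp: mins_def)
    then have "pp_deg v < pp_deg u" using adds_pp_deg_eq[of v u] by force
    from less.hyps[OF this v(1)] show ?thesis using v(2) adds_trans by blast
  qed (use adds_refl in blast)
qed

lemma mspan_mins: "mspan n mins = M"
  using ex_mins up_adds M by (auto simp: mspan_def mins_def)

lemma mins_subset_generators:
  assumes G: "G \<subseteq> monomials n" and "mspan n G = M"
  shows "mins \<subseteq> G"
proof
  fix u assume u: "u \<in> mins"
  then have "u \<in> mspan n G" using assms(2) by (auto simp: mins_def)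
  then obtain g where g: "g \<in> G" "g adds u" by (auto simp: mspan_def)
  then have "g \<in> mspan n G" using G by (auto simp: mspan_def intro: adds_refl)
  then have "g = u" using u g(2) assms(2) by (auto simp: mins_def)
  then show "u \<in> G" using g(1) by simp
qed

lemma keys_sets_eq: "{p :: 'k mpoly. keys p \<subseteq> A} = {p. keys p \<subseteq> B} \<longleftrightarrow> A = B"
proof
  assume *: "{p :: 'k mpoly. keys p \<subseteq> A} = {p. keys p \<subseteq> B}"
  have "u \<in> A \<longleftrightarrow> u \<in> B" for u
    using * by (auto dest: eqset_imp_iff[where x = "mon u :: 'k mpoly"])
  then show "A = B" by blast
qed simp

lemma Idl_eq_I: "G \<subseteq> monomials n \<Longrightarrow> Idl\<^bsub>poly_ring n\<^esub> (mon ` G) = I \<longleftrightarrow> mspan n G = M"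
  by (simp add: Idl_mon I keys_sets_eq)

lemma mins_monomials: "mins \<subseteq> monomials n" using M by (auto simp: mins_def)

text \<open>Every monomial generating set contains \<open>mins\<close>, so \<open>mins\<close> is
  the only one without a generating proper subset, and \<open>THE\<close> is determined.\<close>

lemma min_gens_eq: "min_gens n I = mins"
  unfolding min_gens_def
proof (rule the_equality)
  have "Idl\<^bsub>poly_ring n\<^esub> (mon ` H) \<noteq> I" if "H \<subset> mins" for H
  proof
    have H: "H \<subseteq> monomials n" using that mins_monomials by blast
    assume "Idl\<^bsub>poly_ring n\<^esub> (mon ` H) = I"
    then have "mspan n H = M" using Idl_eq_I[OF H] by blast
    from mins_subset_generators[OF H this] show False using that by blast
  qed
  then show "mins \<subseteq> monomials n \<and> Idl\<^bsub>poly_ring n\<^esub> (mon ` mins) = I \<and> (\<forall>H. H \<subset> mins \<longrightarrow> Idl\<^bsub>poly_ring n\<^esub> (mon ` H) \<noteq> I)"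
    using mins_monomials Idl_eq_I[OF mins_monomials] mspan_mins by blast
next
  fix G assume G: "G \<subseteq> monomials n \<and> Idl\<^bsub>poly_ring n\<^esub> (mon ` G) = I \<and> (\<forall>H. H \<subset> G \<longrightarrow> Idl\<^bsub>poly_ring n\<^esub> (mon ` H) \<noteq> I)"
  then have "mins \<subseteq> G" using mins_subset_generators Idl_eq_I by blast
  moreover have "Idl\<^bsub>poly_ring n\<^esub> (mon ` mins) = I" using mins_monomials Idl_eq_I mspan_mins by blast
  ultimately show "G = mins" using G by blast
qed

lemma finite_mins: "finite mins"
  using mins_monomials by (rule dickson) (auto simp: mins_def)

lemma resolution_exists: "\<exists>F. graded_free_resolution n I F"
proof -
  obtain r and g :: "nat \<Rightarrow> pp" where g: "mins = g ` {i. i < r}"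
    using finite_mins by (metis finite_imp_nat_seg_image_inj_on)
  have M_iff: "u \<in> M \<longleftrightarrow> u \<in> monomials n \<and> (\<exists>t<r. g t adds u)" for u
    using mspan_mins unfolding g by (auto simp: mspan_def)
  interpret taylor n r g I
  proof
    show "g t \<in> monomials n" if "t < r" for t using mins_monomials that by (auto simp: g)
    show "I = {p. keys p \<subseteq> monomials n \<and> (\<forall>u\<in>keys p. \<exists>t<r. g t adds u)}"
      unfolding I using M_iff by (auto simp: subset_iff)
  qed
  show ?thesis using tcomplex_resolution by blast
qed

end

lemma monomial_ideal_mon_ideal:
  fixes I :: "'k::field mpoly set"
  assumes "monomial_ideal n I"
  obtains M where "mon_ideal n M I"
proof -
  obtain U where U: "U \<subseteq> monomials n" "I = Idl\<^bsub>poly_ring n\<^esub> (mon ` U)" using assms by (auto simp: monomial_ideal_def)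
  have "mon_ideal n (mspan n U) I"
    by unfold_locales (auto simp: U(2) Idl_mon[OF U(1)] mspan_add, auto simp: mspan_def)
  then show ?thesis by (rule that)
qed

section \<open>Associated primes\<close>

text \<open>This is the ideal generated by the variables outside \<open>B\<close>. It is the kernel
  of setting these variables to zero, and polynomials have no zero divisors.\<close>

lemma primeideal_vars:
  assumes "B \<subseteq> {1..n}"
  shows "primeideal {p :: 'k::field mpoly. keys p \<subseteq> {u \<in> monomials n. \<not> keys u \<subseteq> B}} (poly_ring n)"
    (is "primeideal ?P _")
proof (rule primeidealI)
  show "ideal ?P (poly_ring n)"
    by (rule ideal_keys) auto
  show "cring (poly_ring n :: 'k mpoly ring)" by (rule cring_poly_ring)
  have "(1 :: 'k mpoly) \<notin> ?P" "(1 :: 'k mpoly) \<in> carrier (poly_ring n)" by simp_all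
  then show "carrier (poly_ring n) \<noteq> ?P" by blast
  fix p q :: "'k mpoly"
  assume p: "p \<in> carrier (poly_ring n)" and q: "q \<in> carrier (poly_ring n)"
    and "p \<otimes>\<^bsub>poly_ring n\<^esub> q \<in> ?P"
  then have pq: "keys (p * q) \<subseteq> {u \<in> monomials n. \<not> keys u \<subseteq> B}" by simp
  define res where "res x = Poly_Mapping.mapp (\<lambda>u c. if keys u \<subseteq> B then c else 0) x" for x :: "'k mpoly"
  have lres: "lookup (res x) u = (if keys u \<subseteq> B then lookup x u else 0)" for x u
    by (simp add: res_def lookup_mapp when_def in_keys_iff)
  define p1 where "p1 = p - res p"
  define q1 where "q1 = q - res q"
  have p1: "\<not> keys u \<subseteq> B" if "u \<in> keys p1" for u
    using that by (auto simp: p1_def in_keys_iff lookup_minus lres split: if_splits)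
  have q1: "\<not> keys u \<subseteq> B" if "u \<in> keys q1" for u
    using that by (auto simp: q1_def in_keys_iff lookup_minus lres split: if_splits)
  have "u \<notin> keys (res p * res q)" for u
  proof
    assume u: "u \<in> keys (res p * res q)"
    then obtain x y where "x \<in> keys (res p)" "y \<in> keys (res q)" "u = x + y" by (rule keys_mult_ex)
    then have uB: "keys u \<subseteq> B" by (auto simp: in_keys_iff lres split: if_splits)
    have "u \<notin> keys (p1 * q)" by (metis keys_mult_ex p1 uB keys_add_pp Un_subset_iff)
    moreover have "u \<notin> keys (res p * q1)" by (metis keys_mult_ex q1 uB keys_add_pp Un_subset_iff)
    moreover have "u \<notin> keys (p * q)" using pq uB by blast
    moreover have "p * q = res p * res q + res p * q1 + p1 * q"
      by (simp add: p1_def q1_def algebra_simps)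
    ultimately show False using u by (simp add: in_keys_iff lookup_add)
  qed
  then have "res p * res q = 0" by (intro poly_mapping_eqI) (simp add: in_keys_iff)
  then have "res p = 0 \<or> res q = 0" by simp
  then have "p1 = p \<or> q1 = q" by (auto simp: p1_def q1_def)
  then show "p \<in> ?P \<or> q \<in> ?P" using p q p1 q1 by auto
qed

context mon_ideal
begin

text \<open>A face \<open>B\<close> that is maximal among those avoiding \<open>M\<close> from some multiple of \<open>v\<close> is the
  complement of an associated prime.\<close>

lemma ex_Ass:
  assumes v: "v \<in> monomials n" and l: "l \<in> {1..n}" and nil: "\<And>N. v + single l N \<notin> M"
  obtains P where "P \<in> Ass_quot (poly_ring n) I" "mon (single l 1) \<notin> P"
    "\<And>k. k \<in> {1..n} \<Longrightarrow> v + single k 1 \<in> M \<Longrightarrow> mon (single k 1) \<in> P"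
proof -
  \<comment> \<open>The last condition says that some multiple \<open>w\<close> of \<open>v\<close>
    stays outside \<open>M\<close> even after the variables in \<open>B\<close> are
    inverted.\<close>
  define F where "F B \<longleftrightarrow> l \<in> B \<and> B \<subseteq> {1..n} \<and>
    (\<exists>w\<in>monomials n. v adds w \<and> (\<forall>b. keys b \<subseteq> B \<longrightarrow> w + b \<notin> M))" for B
  have "F {l}"
  proof -
    have "v + b \<notin> M" if "keys b \<subseteq> {l}" for b
    proof -
      have "b = single l (lookup b l)"
        by (rule poly_mapping_eqI) (use that in \<open>auto simp: lookup_single when_def in_keys_iff\<close>)
      then show ?thesis using nil by metis
    qed
    then show ?thesis unfolding F_def using l v adds_refl by blast
  qed
  moreover have "finite {B. F B}" by (rule finite_subset[of _ "Pow {1..n}"]) (auto simp: F_def)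
  ultimately obtain B where B: "F B" and Bmax: "\<And>C. F C \<Longrightarrow> B \<subseteq> C \<Longrightarrow> B = C"
    using finite_has_maximal[of "{B. F B}"] by auto
  then obtain w where w: "w \<in> monomials n" "v adds w" "\<And>b. keys b \<subseteq> B \<Longrightarrow> w + b \<notin> M"
    and lB: "l \<in> B" and Bn: "B \<subseteq> {1..n}" unfolding F_def by blast
  \<comment> \<open>By maximality \<open>B\<close> cannot be enlarged by i: a power of x_i and a
    monomial in \<open>B\<close> together carry \<open>w\<close> into \<open>M\<close>.\<close>
  have esc: "\<exists>N b. keys b \<subseteq> B \<and> w + single i N + b \<in> M" if i: "i \<in> {1..n} - B" for i
  proof -
    have "\<not> F (insert i B)" using Bmax[of "insert i B"] i by blast
    then obtain b where b: "keys b \<subseteq> insert i B" "w + b \<in> M"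
      unfolding F_def using w lB Bn i by blast
    define b' where "b' = b - single i (lookup b i)"
    have "x \<in> keys b \<and> x \<noteq> i" if "x \<in> keys b'" for x
      using that by (auto simp: b'_def in_keys_iff lookup_minus lookup_single when_def split: if_splits)
    then have "keys b' \<subseteq> B" using b(1) by blast
    moreover have "single i (lookup b i) + b' = b"
      unfolding b'_def by (rule adds_add_diff) (simp add: adds_pp_def lookup_single when_def)
    ultimately show ?thesis using b(2) by (metis add.assoc)
  qed
  then obtain N where N: "\<And>i. i \<in> {1..n} - B \<Longrightarrow> \<exists>b. keys b \<subseteq> B \<and> w + single i (N i) + b \<in> M" by metis
  \<comment> \<open>Monomials in the variables outside \<open>B\<close> that keep \<open>w\<close>
    outside \<open>M\<close> whatever factor in \<open>B\<close> is added. Their exponents are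
    bounded by \<open>N\<close>, and one of maximal degree gives a socle element after inverting
    \<open>B\<close>.\<close>
  define C where "C c \<longleftrightarrow> keys c \<subseteq> {1..n} - B \<and> (\<forall>b. keys b \<subseteq> B \<longrightarrow> w + c + b \<notin> M)" for c
  have C0: "C 0" using w(3) by (simp add: C_def)
  have bound: "pp_deg c \<le> (\<Sum>i\<in>{1..n} - B. N i)" if c: "C c" for c
  proof -
    have le: "lookup c i \<le> N i" if i: "i \<in> {1..n} - B" for i
    proof (rule ccontr)
      assume "\<not> lookup c i \<le> N i"
      then have "single i (N i) adds c" by (auto simp: adds_pp_def lookup_single when_def)
      then obtain c' where c': "c = single i (N i) + c'" by (auto simp: adds_iff_ex)
      obtain b where b: "keys b \<subseteq> B" "w + single i (N i) + b \<in> M" using N[OF i] by blast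
      have "c' \<in> monomials n" using c c' by (auto simp: C_def monomials_def)
      from up[OF b(2) this] have "w + c + b \<in> M" by (simp add: c' ac_simps)
      then show False using c b(1) by (auto simp: C_def)
    qed
    have "pp_deg c = (\<Sum>i\<in>{1..n} - B. lookup c i)" using c by (intro pp_deg_superset) (auto simp: C_def)
    also have "\<dots> \<le> (\<Sum>i\<in>{1..n} - B. N i)" by (rule sum_mono[OF le])
    finally show ?thesis .
  qed
  obtain c where c: "C c" and cmax: "\<And>c'. C c' \<Longrightarrow> pp_deg c' \<le> pp_deg c"
  proof -
    have "\<exists>x. C x \<and> (\<forall>y. C y \<longrightarrow> pp_deg y \<le> pp_deg x)"
      by (rule ex_has_greatest_nat[of C 0 pp_deg "Suc (\<Sum>i\<in>{1..n} - B. N i)"]) (use C0 bound in \<open>auto simp: less_Suc_eq_le\<close>)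
    then show ?thesis using that by blast
  qed
  have "\<exists>b. keys b \<subseteq> B \<and> w + c + single i 1 + b \<in> M" if i: "i \<in> {1..n} - B" for i
  proof -
    have "\<not> C (c + single i 1)" using cmax[of "c + single i 1"] by auto
    then show ?thesis using c i unfolding C_def by (auto simp: add.assoc split: if_splits)
  qed
  then obtain b where b: "\<And>i. i \<in> {1..n} - B \<Longrightarrow> keys (b i) \<subseteq> B \<and> w + c + single i 1 + b i \<in> M" by metis
  \<comment> \<open>One factor supported in \<open>B\<close> that serves all i at once, since every
    \<open>b i\<close> divides it.\<close>
  define s where "s = (\<Sum>i\<in>{1..n} - B. b i)"
  have keys_sum_pp: "keys (sum f A) \<subseteq> B" if "\<And>i. i \<in> A \<Longrightarrow> keys (f i) \<subseteq> B" for f :: "nat \<Rightarrow> pp" and A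
    using that by (induction A rule: infinite_finite_induct) auto
  have sB: "keys s \<subseteq> B" unfolding s_def using b by (intro keys_sum_pp) auto
  define f where "f = w + c + s"
  have fmon: "f \<in> monomials n"
    using w(1) c sB Bn by (auto simp: f_def C_def monomials_def)
  \<comment> \<open>The monomials carrying \<open>f\<close> into \<open>M\<close> are those not
    supported in \<open>B\<close>, so the annihilator of \<open>f\<close> modulo \<open>I\<close> is
    the prime generated by the variables outside \<open>B\<close>.\<close>
  have in_M: "u + f \<in> M \<longleftrightarrow> \<not> keys u \<subseteq> B" if u: "u \<in> monomials n" for u
  proof
    assume "u + f \<in> M"
    show "\<not> keys u \<subseteq> B"
    proof
      assume "keys u \<subseteq> B"
      then have "keys (s + u) \<subseteq> B" using sB by simp
      then have "w + c + (s + u) \<notin> M" using c unfolding C_def by blast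
      with \<open>u + f \<in> M\<close> show False by (simp add: f_def ac_simps)
    qed
  next
    assume "\<not> keys u \<subseteq> B"
    then obtain i where i: "i \<in> keys u" "i \<notin> B" by blast
    then have i': "i \<in> {1..n} - B" using u by (auto simp: monomials_def)
    obtain u' where u': "u = single i 1 + u'" using i(1) single_adds_iff by (auto simp: adds_iff_ex)
    obtain s' where s': "s = b i + s'" using sum.remove[OF _ i', of b] by (auto simp: s_def)
    have "u' + s' \<in> monomials n" using u u' sB s' Bn by (auto simp: monomials_def)
    with up[of "w + c + single i 1 + b i" "u' + s'"] b[OF i'] show "u + f \<in> M"
      by (simp add: f_def u' s' ac_simps)
  qed
  define P :: "'k mpoly set" where "P = {p. keys p \<subseteq> {u \<in> monomials n. \<not> keys u \<subseteq> B}}"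
  have key: "u \<in> keys (p * mon f) \<longleftrightarrow> f adds u \<and> u - f \<in> keys p" for u and p :: "'k mpoly"
    by (subst mult.commute) (simp add: in_keys_iff lookup_single_mult)
  have ann: "p * mon f \<in> I \<longleftrightarrow> p \<in> P" if p: "p \<in> carrier (poly_ring n)" for p
  proof
    assume pf: "p * mon f \<in> I"
    have "\<not> keys u \<subseteq> B" if "u \<in> keys p" for u
    proof -
      have "u + f \<in> M" using key[of "u + f" p] that pf by (auto simp: I)
      then show ?thesis using in_M p that by auto
    qed
    then show "p \<in> P" using p by (auto simp: P_def)
  next
    assume "p \<in> P"
    have "u \<in> M" if "u \<in> keys (p * mon f)" for u
    proof -
      have "f adds u" "u - f \<in> keys p" using that key by auto
      then have "u - f \<in> monomials n" "\<not> keys (u - f) \<subseteq> B" using \<open>p \<in> P\<close> by (auto simp: P_def)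
      then show ?thesis using in_M[of "u - f"] \<open>f adds u\<close> by (simp add: adds_diff_add)
    qed
    then show "p * mon f \<in> I" by (auto simp: I)
  qed
  have "P = {p \<in> carrier (poly_ring n). p \<otimes>\<^bsub>poly_ring n\<^esub> mon f \<in> I}"
    using ann by (auto simp: P_def)
  moreover have "primeideal P (poly_ring n)" unfolding P_def using Bn by (rule primeideal_vars)
  moreover have "mon f \<in> carrier (poly_ring n)" using fmon by simp
  ultimately have 1: "P \<in> Ass_quot (poly_ring n) I"
    unfolding Ass_quot_def by blast
  have 2: "mon (single l 1) \<notin> P" using lB by (simp add: P_def)
  have 3: "mon (single k 1) \<in> P" if k: "k \<in> {1..n}" and vk: "v + single k 1 \<in> M" for k
  proof -
    obtain x where x: "w = v + x" using w(2) by (auto simp: adds_iff_ex)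
    have "x + c + s \<in> monomials n" using fmon by (simp add: f_def x)
    from up[OF vk this] have "single k 1 + f \<in> M" by (simp add: f_def x ac_simps)
    then have "\<not> keys (single k (1::nat)) \<subseteq> B" using in_M[of "single k 1"] k by simp
    then show ?thesis using k by (simp add: P_def)
  qed
  show ?thesis by (rule that[OF 1 2 3])
qed

end

section \<open>The regularity bound\<close>

text \<open>Each variable determines the set of primes in \<open>X\<close> that contain it. For a
  chain these sets are nested, and a variable with the smallest one is wanted.\<close>

lemma ex_last_variable:
  fixes X :: "'k::field mpoly set set"
  assumes chain: "\<And>P Q. P \<in> X \<Longrightarrow> Q \<in> X \<Longrightarrow> P \<subseteq> Q \<or> Q \<subseteq> P"
    and "finite A" "A \<noteq> {}"
  shows "\<exists>k\<in>A. \<forall>l\<in>A. \<forall>P\<in>X. x k \<in> P \<longrightarrow> x l \<in> P"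
  using assms(2,3)
proof (induction A rule: finite_ne_induct)
  case (singleton a)
  then show ?case by simp
next
  case (insert a A)
  then obtain k where k: "k \<in> A" "\<forall>l\<in>A. \<forall>P\<in>X. x k \<in> P \<longrightarrow> x l \<in> P" by blast
  show ?case
  proof (cases "\<forall>P\<in>X. x k \<in> P \<longrightarrow> x a \<in> P")
    case True
    with k show ?thesis by (intro bexI[of _ k]) auto
  next
    case False
    then obtain Q where Q: "Q \<in> X" "x k \<in> Q" "x a \<notin> Q" by blast
    \<comment> \<open>\<open>P\<close> contains \<open>x a\<close> while \<open>Q\<close> does not,
      so \<open>P\<close> is not inside \<open>Q\<close> and must contain it.\<close>
    have "x k \<in> P" if "P \<in> X" "x a \<in> P" for P using chain[OF that(1) Q(1)] that(2) Q by blast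
    then have "\<forall>l\<in>insert a A. \<forall>P\<in>X. x a \<in> P \<longrightarrow> x l \<in> P" using k by blast
    then show ?thesis by blast
  qed
qed

context mon_ideal
begin

text \<open>\<open>a\<close> is the multidegree of a strand and \<open>k\<close> its apex, with
  \<open>last\<close> coming from \<open>ex_last_variable\<close>. In the constant, m (d - 1) bounds
  the degree of v; the 2 accounts for the dropped variable and for exceeding the bound.\<close>

lemma drop_last_variable:
  assumes u: "u \<in> M" and k: "k \<in> keys u" and a: "u adds a"
    and last: "\<And>l P. l \<in> keys a \<Longrightarrow> P \<in> Ass_quot (poly_ring n) I \<Longrightarrow> mon (single k 1) \<in> P \<Longrightarrow> mon (single l 1) \<in> P"
    and gens: "\<And>g. g \<in> mins \<Longrightarrow> pp_deg g \<le> d \<and> keys g \<subseteq> {1..m}"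
    and deg: "pp_deg u \<ge> m * (d - 1) + 2"
  shows "u - single k 1 \<in> M"
proof (rule ccontr)
  define v where "v = u - single k 1"
  assume "u - single k 1 \<notin> M"
  then have v: "v \<notin> M" by (simp add: v_def)
  have uv: "v + single k 1 = u" unfolding v_def using k by (intro adds_diff_add) simp
  have vn: "v \<in> monomials n" "k \<in> {1..n}" using u M uv by (auto simp flip: uv)
  have "keys v \<subseteq> keys u" by (auto simp flip: uv)
  also have "\<dots> \<subseteq> keys a" using a by (auto simp: adds_iff_ex)
  finally have va: "keys v \<subseteq> keys a" .
  have small: "l \<in> {1..m} \<and> lookup v l \<le> d - 1" if l: "l \<in> keys v" for l
  proof -
    have ln: "l \<in> {1..n}" using l vn by (auto simp: monomials_def)
    have "\<exists>N. v + single l N \<in> M"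
    proof (rule ccontr)
      assume "\<nexists>N. v + single l N \<in> M"
      then obtain P where "P \<in> Ass_quot (poly_ring n) I" "mon (single l 1) \<notin> P"
        "\<And>k. k \<in> {1..n} \<Longrightarrow> v + single k 1 \<in> M \<Longrightarrow> mon (single k 1) \<in> P"
        using ex_Ass[OF vn(1) ln] by metis
      then show False using last[of l P] l va vn(2) u uv by auto
    qed
    then obtain N g where g: "g \<in> mins" "g adds v + single l N" using ex_mins by blast
    \<comment> \<open>\<open>g\<close> divides v x_l^N but not v, so some exponent of
      \<open>g\<close> exceeds that of v, which can happen only at l.\<close>
    have "\<not> g adds v" using v up_adds[of g v] vn(1) g(1) by (auto simp: mins_def)
    then obtain i where i: "lookup v i < lookup g i" by (auto simp: adds_pp_def not_le)
    have "lookup g i \<le> lookup v i + lookup (single l N) i" using g(2) by (simp add: adds_pp_def lookup_add)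
    then have "i = l" using i by (auto simp: lookup_single when_def split: if_splits)
    then have "l \<in> keys g" "lookup v l < lookup g l" using i by (auto simp: in_keys_iff)
    moreover have "lookup g l \<le> d" using gens[OF g(1)] lookup_le_pp_deg[of g l] by linarith
    ultimately show ?thesis using gens[OF g(1)] by auto
  qed
  have "pp_deg v \<le> (\<Sum>l\<in>keys v. d - 1)" unfolding pp_deg_def by (rule sum_mono) (use small in blast)
  also have "\<dots> = card (keys v) * (d - 1)" by simp
  also have "\<dots> \<le> m * (d - 1)"
  proof (rule mult_right_mono)
    have "keys v \<subseteq> {1..m}" using small by blast
    then show "card (keys v) \<le> m" using card_mono[of "{1..m}" "keys v"] by simp
  qed simp
  finally have "pp_deg v \<le> m * (d - 1)" .
  moreover have "pp_deg u = pp_deg v + 1" by (simp flip: uv)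
  ultimately show False using deg by linarith
qed

end

section \<open>Vanishing of Koszul homology in low and in high degrees\<close>

lemma koszul_diff_zero [simp]: "koszul_diff n (\<lambda>_. 0) = (\<lambda>_. 0)"
  by (simp add: koszul_diff_def fun_eq_iff)

context mon_ideal
begin

context
  fixes F :: "'k free_complex"
  assumes F: "graded_free_resolution n I F"
begin

interpretation aug_res n I "aug_basis F" "aug_deg F" "aug_bdry F" by (rule aug_res_of_resolution[OF F])

text \<open>The coefficients would have negative degree. This bounds the set in \<open>reg\<close>
  from below, which enters its finiteness.\<close>

lemma koszul_vanish_low_degree:
  assumes "j < int i"
  shows "koszul_vanish i j"
  unfolding koszul_vanish_def
proof (intro ballI impI)
  fix f :: "nat set \<Rightarrow> nat \<Rightarrow>\<^sub>0 'k mpoly"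
  assume f: "f \<in> koszul_chain n (aug_basis F 0) (aug_deg F 0) i j"
  have "f T = 0" for T
  proof (rule ccontr)
    assume nz: "f T \<noteq> 0"
    then obtain b where "keys (lookup (f T) b) \<noteq> {}" by (metis keys_eq_empty lookup_zero poly_mapping_eqI)
    then obtain u where "u \<in> keys (lookup (f T) b)" by blast
    from hom_mod_deg[OF koszul_chain_hom[OF f] this] have "int (pp_deg u) = j - int i" by simp
    then show False using assms by linarith
  qed
  then have "f = (\<lambda>_. 0)" by auto
  moreover have "(\<lambda>_. 0) \<in> koszul_chain n (aug_basis F 0) (aug_deg F 0) (Suc i) j" by (simp add: koszul_chain_def)
  moreover have "range (\<lambda>_::nat set. 0 :: nat \<Rightarrow>\<^sub>0 'k mpoly) \<subseteq> single 0 ` I" by (auto simp: I intro!: image_eqI[of _ _ 0])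
  ultimately show "\<exists>g\<in>koszul_chain n (aug_basis F 0) (aug_deg F 0) (Suc i) j. range g \<subseteq> single 0 ` I \<and> koszul_diff n g = f"
    by (intro bexI[of _ "\<lambda>_. 0"]) auto
qed

text \<open>All coefficients of the chain have degree j - i, so \<open>drop_last_variable\<close>
  applies to each of their monomials. Filling by cones only cancels the apex variable and therefore
  stays in \<open>I\<close>.\<close>

lemma koszul_vanish_high_degree:
  assumes chain: "\<And>P Q. P \<in> Ass_quot (poly_ring n) I \<Longrightarrow> Q \<in> Ass_quot (poly_ring n) I \<Longrightarrow> P \<subseteq> Q \<or> Q \<subseteq> P"
    and gens: "\<And>g. g \<in> mins \<Longrightarrow> pp_deg g \<le> d \<and> keys g \<subseteq> {1..m}"
    and j: "j - int i \<ge> int (m * (d - 1) + 2)"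
  shows "koszul_vanish i j"
  unfolding koszul_vanish_def
proof (intro ballI impI)
  fix f :: "nat set \<Rightarrow> nat \<Rightarrow>\<^sub>0 'k mpoly"
  assume f: "f \<in> koszul_chain n (aug_basis F 0) (aug_deg F 0) i j" and fI: "range f \<subseteq> single 0 ` I" and cyc: "\<forall>T. koszul_diff n f T = 0"
  define Q where "Q a k \<longleftrightarrow> k \<in> keys a \<and>
    (\<forall>l\<in>keys a. \<forall>P\<in>Ass_quot (poly_ring n) I. mon (single k 1) \<in> P \<longrightarrow> mon (single l 1) \<in> P)" for a :: pp and k
  have "\<exists>k. Q a k" if "a \<noteq> 0" for a
    using ex_last_variable[OF chain finite_keys[of a], of "Ass_quot (poly_ring n) I" "\<lambda>k. mon (single k 1)"] that
    unfolding Q_def by (simp add: Bex_def)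
  then obtain \<kappa> where "\<And>a. a \<noteq> 0 \<Longrightarrow> Q a (\<kappa> a)" by metis
  then have \<kappa>: "\<And>a. a \<noteq> 0 \<Longrightarrow> \<kappa> a \<in> keys a"
    "\<And>a l P. a \<noteq> 0 \<Longrightarrow> l \<in> keys a \<Longrightarrow> P \<in> Ass_quot (poly_ring n) I \<Longrightarrow> mon (single (\<kappa> a) 1) \<in> P \<Longrightarrow> mon (single l 1) \<in> P"
    unfolding Q_def by blast+
  have deg: "pp_deg u \<ge> m * (d - 1) + 2" if "u \<in> keys (lookup (f T) b)" for T b u
  proof -
    have "int (pp_deg u) = j - int i" using hom_mod_deg[OF koszul_chain_hom[OF f] that] by simp
    then show ?thesis using j by linarith
  qed
  have inM: "u \<in> M" if "u \<in> keys (lookup (f T) b)" for T b u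
  proof -
    have "f T \<in> single 0 ` I" using fI by auto
    then obtain p where p: "p \<in> I" "f T = single 0 p" by blast
    then show ?thesis using that by (auto simp: I lookup_single when_def split: if_splits)
  qed
  have apex: "\<kappa> (var_label T + u) \<in> keys (var_label T + u)" if "T \<subseteq> {1..n}" "u \<in> keys (lookup (f T) b)" for T b u
    using deg[OF that(2)] by (intro \<kappa>(1)) auto
  obtain g where g: "g \<in> koszul_chain n (aug_basis F 0) (aug_deg F 0) (Suc i) j" "koszul_diff n g = f"
    "\<And>T b u. u \<in> keys (lookup (g T) b) \<Longrightarrow> \<exists>k w. k = \<kappa> (var_label T + u) \<and> k \<in> T \<and> w \<in> keys (lookup (f (T - {k})) b) \<and>
       single k 1 + u = w"
    by (rule koszul_exact[of f n "aug_basis F 0" "aug_deg F 0" i j \<kappa>, OF f _ apex]) (use cyc in blast)+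
  have gM: "u \<in> M" if u: "u \<in> keys (lookup (g T) b)" for T b u
  proof -
    define a where "a = var_label T + u"
    obtain k w where k: "k = \<kappa> a" "k \<in> T" and w: "w \<in> keys (lookup (f (T - {k})) b)" "single k 1 + u = w"
      using g(3)[OF u] unfolding a_def by blast
    have "g T \<noteq> 0" using u by auto
    then have "finite T" using koszul_chain_supp[OF g(1), of T] finite_subset[of T "{1..n}"] by auto
    \<comment> \<open>The multidegree \<open>a\<close> is x_T u with k in T, so w = x_k u divides
      it.\<close>
    then have "single k 1 adds var_label T" using k(2) by (auto simp: adds_pp_def lookup_var_label lookup_single when_def)
    then have wa: "w adds a" unfolding a_def by (simp flip: w(2))
    have "a \<noteq> 0" using wa deg[OF w(1)] adds_pp_deg[OF wa] by auto
    then have last: "\<And>l P. l \<in> keys a \<Longrightarrow> P \<in> Ass_quot (poly_ring n) I \<Longrightarrow> mon (single k 1) \<in> P \<Longrightarrow> mon (single l 1) \<in> P"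
      using \<kappa>(2)[of a] unfolding k(1) by blast
    have "k \<in> keys w" by (simp flip: w(2))
    from drop_last_variable[OF inM[OF w(1)] this wa last gens deg[OF w(1)]]
    have "w - single k 1 \<in> M" by blast
    then show ?thesis by (simp flip: w(2))
  qed
  have "range g \<subseteq> single 0 ` I"
  proof
    fix v assume "v \<in> range g"
    then obtain T where v: "v = g T" by blast
    \<comment> \<open>The module has the single basis element 0, so \<open>v\<close> amounts to one
      polynomial.\<close>
    have "v = single 0 (lookup v 0)"
    proof (rule poly_mapping_eqI)
      fix b
      have "keys v \<subseteq> {0}" using hom_mod_free[OF koszul_chain_hom[OF g(1), of T]] by (simp add: v free_mod_def)
      then have "lookup v b = 0" if "b \<noteq> 0" using that by (meson in_keys_iff singletonD subsetD)
      then show "lookup v b = lookup (single 0 (lookup v 0)) b" by (simp add: lookup_single when_def)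
    qed
    moreover have "lookup v 0 \<in> I" using gM by (auto simp: I v)
    ultimately show "v \<in> single 0 ` I" by blast
  qed
  then show "\<exists>g\<in>koszul_chain n (aug_basis F 0) (aug_deg F 0) (Suc i) j. range g \<subseteq> single 0 ` I \<and> koszul_diff n g = f"
    using g(1,2) by blast
qed

end

end

theorem corollary2p5:
  fixes n :: nat and I :: "('k::field) mpoly set"
  assumes "n \<ge> 2"
    and "monomial_ideal n I"
    and "I \<noteq> {0}"
    and "\<And>P Q. P \<in> Ass_quot (poly_ring n) I \<Longrightarrow> Q \<in> Ass_quot (poly_ring n) I \<Longrightarrow> P \<subseteq> Q \<or> Q \<subseteq> P"
  shows "reg n I \<le> int (ideal_max n I) * (int (ideal_deg n I) - 1) + 1"
proof -
  obtain M where "mon_ideal n M I" using assms(2) by (rule monomial_ideal_mon_ideal)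
  then interpret mon_ideal n M I .
  define F where "F = (SOME F. graded_free_resolution n I F)"
  have F: "graded_free_resolution n I F" unfolding F_def using resolution_exists by (rule someI_ex)
  have betti: "betti n I i j = quot_dim (tensor_cycles F i j) (tensor_boundaries F i j)" for i j
    by (simp add: betti_def F_def Let_def)
  define d where "d = ideal_deg n I"
  define m where "m = ideal_max n I"
  have "M \<noteq> {}"
  proof
    assume "M = {}"
    then have "I = {0}" by (auto simp: I)
    then show False using assms(3) by simp
  qed
  then obtain u0 where u0: "u0 \<in> M" "\<And>u. u \<in> M \<Longrightarrow> pp_deg u0 \<le> pp_deg u"
    using ex_has_least_nat[of "\<lambda>u. u \<in> M" _ pp_deg] by blast
  have mins_ne: "mins \<noteq> {}" using ex_mins[OF u0(1)] by blast
  have gens: "pp_deg g \<le> d \<and> keys g \<subseteq> {1..m}" if g: "g \<in> mins" for g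
  proof
    show "pp_deg g \<le> d" using g finite_mins by (simp add: d_def ideal_deg_def min_gens_eq)
    show "keys g \<subseteq> {1..m}"
    proof
      fix l assume l: "l \<in> keys g"
      then have "l \<le> pp_max g" by (auto simp: pp_max_def)
      moreover have "pp_max g \<le> m" using g finite_mins by (simp add: m_def ideal_max_def min_gens_eq)
      moreover have "l \<ge> 1" using l g mins_monomials by (fastforce simp: monomials_def)
      ultimately show "l \<in> {1..m}" by simp
    qed
  qed
  \<comment> \<open>For d = 0 the truncated \<open>d - 1\<close> differs from the integer one. In
    that case 1 is the only generator, and both products vanish because m = 0.\<close>
  have "m = 0" if "d = 0"
  proof -
    have "g = 0" if "g \<in> mins" for g using gens[OF that] \<open>d = 0\<close> by simp
    then have "mins = {0}" using mins_ne by blast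
    then show ?thesis by (simp add: m_def ideal_max_def min_gens_eq pp_max_def)
  qed
  then have bound: "int m * (int d - 1) + 1 = int (m * (d - 1)) + 1" by (cases d) auto
  define S where "S = {j - int i | i j. betti n I i j \<noteq> 0}"
  have S: "x \<in> {0..int m * (int d - 1) + 1}" if xS: "x \<in> S" for x
  proof -
    obtain i j where x: "x = j - int i" "betti n I i j \<noteq> 0" using xS by (auto simp: S_def)
    then have nv: "\<not> aug_res.koszul_vanish n I (aug_basis F) (aug_deg F) i j"
      using tensor_cycles_boundaries[OF F] quot_dim_eq_0 betti by metis
    have "j \<ge> int i" using koszul_vanish_low_degree[OF F] nv not_le by blast
    moreover have "j - int i < int (m * (d - 1) + 2)"
      using koszul_vanish_high_degree[OF F assms(4) gens, of j i] nv by linarith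
    ultimately show ?thesis by (simp add: x bound)
  qed
  \<comment> \<open>\<open>Max\<close> is meaningful only for a nonempty finite set; a monomial of
    least degree shows that \<open>S\<close> is nonempty.\<close>
  have "betti n I 0 (int (pp_deg u0)) \<noteq> 0"
    unfolding betti using F
  proof (rule betti_0_nonzero)
    show "mon u0 \<in> I" "u0 \<in> monomials n" using u0(1) M by (auto simp: I)
    show "pp_deg u0 \<le> pp_deg u" if "p \<in> I" "u \<in> keys p" for p u using that u0(2) by (auto simp: I)
  qed
  then have "int (pp_deg u0) - int 0 \<in> S" unfolding S_def by blast
  then have "S \<noteq> {}" by blast
  moreover have "finite S" using S by (intro finite_subset[of S "{0..int m * (int d - 1) + 1}"]) auto
  ultimately have "Max S \<in> S" by (rule Max_in[rotated])
  then have "Max S \<le> int m * (int d - 1) + 1" using S by auto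
  then show ?thesis by (simp add: reg_def S_def m_def d_def)
qed

end
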